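(* Let $k\ge 1$ be an integer. Suppose that Khintchine's theorem holds, i.e. for every monotonic function $\psi:\mathbb{R}^+\to\mathbb{R}^+$, $$\sum_{n=1}^{\infty}\left(\frac{\phi(n)\,\psi(n)}{n}\right)^k=\infty\quad\Longrightarrow\quad m(\mathcal{S}_k(\psi))=1 .$$ Then Jarník's theorem holds, i.e. for every monotonic function $\psi:\mathbb{R}^+\to\mathbb{R}^+$ and every dimension function $f$ such that $r\mapsto r^{-k}f(r)$ is monotonic, $$\sum_{n=1}^{\infty} f\!\left(\frac{\psi(n)}{n}\right)\phi(n)^k=\infty\quad\Longrightarrow\quad \mathcal{H}^f(\mathcal{S}_k(\psi))=\mathcal{H}^f([0,1]^k).$$
   Context: $\mathbb{R}^+=(0,\infty)$; $\phi$ is the Euler function; $m$ is $k$-dimensional Lebesgue measure. For $\psi:\mathbb{R}^+\to\mathbb{R}^+$, $\mathcal{S}_k(\psi)$ is the set of points $\mathbf{y}=(y_1,\dots,y_k)\in[0,1]^k$ for which there are infinitely many $q\in\mathbb{N}$ and $\mathbf{p}=(p_1,\dots,p_k)\in\mathbb{Z}^k$ such that $\left|y_i-\frac{p_i}{q}\right|<\frac{\psi(q)}{q}$ and $\gcd(p_i,q)=1$ for all $1\le i\le k$. A dimension function is a continuous, nondecreasing function $f:\mathbb{R}^+\to\mathbb{R}^+$ with $f(r)\to0$ as $r\to0$. Balls are closed balls $B(x,r)=\{y: d(x,y)\le r\}$ with fixed centre $x$ and radius $r>0$. For $F\subset\mathbb{R}^k$ and $\rho>0$, let $\mathcal{H}^f_\rho(F)=\inf\sum_i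 f(r(B_i))$, the infimum being over all countable collections of balls $\{B_i\}$ with radii $r(B_i)\le\rho$ and $F\subset\bigcup_iB_i$. The Hausdorff $f$-measure is $\mathcal{H}^f(F)=\lim_{\rho\to0}\mathcal{H}^f_\rho(F)=\sup_{\rho>0}\mathcal{H}^f_\rho(F)$. *)

theory Defs
  imports "HOL-Analysis.Analysis" "HOL-Number_Theory.Totient"
begin

text \<open>
  Functions \<open>\<real>\<^sup>+ \<rightarrow> \<real>\<^sup>+\<close> are total functions on \<^typ>\<open>real\<close> of which only the values on
  \<open>{0<..}\<close> matter. The dimension \<open>k\<close> is \<open>CARD('n)\<close> for the index type of \<open>real ^ 'n\<close>.
\<close>

definition pos_fun :: "(real \<Rightarrow> real) \<Rightarrow> bool" where
  "pos_fun g \<longleftrightarrow> (\<forall>r>0. g r > 0)"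

text \<open>Monotonic means nondecreasing or nonincreasing.\<close>

definition monotonic_pos :: "(real \<Rightarrow> real) \<Rightarrow> bool" where
  "monotonic_pos g \<longleftrightarrow> mono_on {0<..} g \<or> antimono_on {0<..} g"

definition dimension_function :: "(real \<Rightarrow> real) \<Rightarrow> bool" where
  "dimension_function f \<longleftrightarrow>
     pos_fun f \<and> continuous_on {0<..} f \<and> mono_on {0<..} f \<and> (f \<longlongrightarrow> 0) (at_right 0)"

text \<open>The infinitude is that of the set of pairs \<open>(q, p)\<close>, with \<open>q \<ge> 1\<close>.\<close>

definition simul_approx_set :: "(real \<Rightarrow> real) \<Rightarrow> (real ^ 'n) set" where
  "simul_approx_set \<psi> = {y \<in> cbox 0 1. infinite {(q :: nat, p :: int ^ 'n). q \<ge> 1 \<and>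
     (\<forall>i. \<bar>y $ i - of_int (p $ i) / real q\<bar> < \<psi> (real q) / real q \<and> gcd (p $ i) (int q) = 1)}}"

text \<open>
  A ball is given by its centre and radius, since the radius need not be determined by the
  underlying set; a cover is a countable set of such pairs.
\<close>

definition hausdorff_content :: "(real \<Rightarrow> real) \<Rightarrow> real \<Rightarrow> 'a::metric_space set \<Rightarrow> ennreal" where
  "hausdorff_content f \<rho> F =
     (INF C \<in> {C :: ('a \<times> real) set. countable C \<and> (\<forall>(x, r) \<in> C. 0 < r \<and> r \<le> \<rho>) \<and>
                 F \<subseteq> (\<Union>(x, r) \<in> C. cball x r)}.
        \<Sum>\<^sub>\<infinity>(x, r) \<in> C. ennreal (f r))"

definition hausdorff_measure :: "(real \<Rightarrow> real) \<Rightarrow> 'a::metric_space set \<Rightarrow> ennreal" where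
  "hausdorff_measure f F = (SUP \<rho> \<in> {0<..}. hausdorff_content f \<rho> F)"

end

theory Submission
  imports Defs
begin

text \<open>
  Let \<open>k\<close> be the dimension. If \<open>f r / r ^ k\<close> is bounded near \<open>0\<close>, Lebesgue null sets have
  \<open>f\<close>-measure zero (\<open>hausdorff_measure_diff_null\<close>), and it suffices that the approximable points have full
  Lebesgue measure. This follows from Khintchine's theorem, for \<open>\<psi>\<close> itself if \<open>\<psi>\<close> is
  nonincreasing and for the constant \<open>\<psi> 1\<close> otherwise.

  In the other case \<open>f r / r ^ k\<close> is nonincreasing and tends to infinity as \<open>r\<close> tends to \<open>0\<close>, and the claim is
  that the approximable points have infinite \<open>f\<close>-measure (\<open>hausdorff_measure_approx_infinite\<close>). A nondecreasing \<open>\<psi>\<close> may again be replaced by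
  \<open>\<psi> 1\<close>, so let \<open>\<psi>\<close> be nonincreasing. Two results are combined.

  The first one is a mass transference principle (\<open>mass_transference\<close>): if almost every point lies in infinitely many balls
  of radius at most a constant times \<open>f (r i) powr (1 / k)\<close>, then the limsup set of the concentric balls of
  radius \<open>r i\<close> has infinite \<open>f\<close>-measure. Instead of constructing a Cantor set with a suitable
  measure on it, one fixes a cover of finite total mass, where a ball of radius \<open>s\<close> has mass \<open>f s\<close>, and
  finds nested balls of radius \<open>r i\<close> that are met only by a light part of the cover; their common
  point is not covered. The existence of light balls rests on the fact that the part of the cover
  that consists of balls of radius less than \<open>\<rho>\<close> has a mass that tends to \<open>0\<close> with \<open>\<rho>\<close>
  (\<open>mass_transference_step\<close>).

  The second one supplies the hypothesis, for the radii \<open>g q = f (\<psi> q / q) powr (1 / k)\<close>. The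
  sequence \<open>g q\<close> is nonincreasing, but \<open>q * g q\<close>, to which Khintchine's theorem would have to be applied, need
  not be monotonic. It is replaced by a nonincreasing step function with a divergent series that
  exceeds \<open>q * g q\<close> only on blocks of denominators whose contribution converges
  (\<open>monotone_step_function\<close>); these blocks are negligible by the Borel-Cantelli lemma
  (\<open>khintchine_decreasing_radius\<close>).
\<close>

section \<open>Countable sums and unions\<close>

lemma infsum_ennreal_eq_nn_integral:
  fixes g :: "'b \<Rightarrow> ennreal"
  assumes "countable C"
  shows "infsum g C = (\<integral>\<^sup>+x. g x \<partial>count_space C)"
proof (rule antisym)
  show "infsum g C \<le> (\<integral>\<^sup>+x. g x \<partial>count_space C)"
  proof (rule infsum_le_finite_sums)
    fix F assume F: "finite F" "F \<subseteq> C"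
    have "sum g F = (\<Sum>x\<in>F. g x * indicator F x)"
      by (intro sum.cong) auto
    also have "\<dots> = (\<integral>\<^sup>+x. g x * indicator F x \<partial>count_space C)"
      using F by (intro nn_integral_count_space'[symmetric]) auto
    also have "\<dots> \<le> (\<integral>\<^sup>+x. g x \<partial>count_space C)"
      by (intro nn_integral_mono) (auto split: split_indicator)
    finally show "sum g F \<le> (\<integral>\<^sup>+x. g x \<partial>count_space C)" .
  qed (simp add: nonneg_summable_on_complete)
  show "(\<integral>\<^sup>+x. g x \<partial>count_space C) \<le> infsum g C"
  proof (cases "finite C")
    case True
    then show ?thesis by (simp add: nn_integral_count_space_finite)
  next
    case False
    define e where "e = from_nat_into C"
    have e: "bij_betw e UNIV C"
      unfolding e_def using assms False by (rule bij_betw_from_nat_into)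
    have "(\<integral>\<^sup>+x. g x \<partial>count_space C) = (\<integral>\<^sup>+n. g (e n) \<partial>count_space UNIV)"
      using nn_integral_bij_count_space[OF e] by simp
    also have "\<dots> = (\<Sum>n. g (e n))"
      by (rule nn_integral_count_space_nat)
    also have "\<dots> \<le> infsum g C"
    proof (rule suminf_le_const)
      fix n
      have "sum (\<lambda>n. g (e n)) {..<n} = sum g (e ` {..<n})"
        using e by (subst sum.reindex) (auto simp: bij_betw_def intro: inj_on_subset)
      also have "\<dots> \<le> infsum g C"
        using e by (subst nonneg_infsum_complete) (auto simp: bij_betw_def intro!: SUP_upper)
      finally show "sum (\<lambda>n. g (e n)) {..<n} \<le> infsum g C" .
    qed simp
    finally show ?thesis .
  qed
qed

lemma emeasure_UN_countable_le:
  assumes "countable I" and X: "\<And>i. i \<in> I \<Longrightarrow> X i \<in> sets M"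
  shows "emeasure M (\<Union>i\<in>I. X i) \<le> (\<integral>\<^sup>+i. emeasure M (X i) \<partial>count_space I)"
proof -
  have m: "(\<Union>i\<in>I. X i) \<in> sets M"
    using assms by (intro sets.countable_UN') auto
  have "emeasure M (\<Union>i\<in>I. X i) = (\<integral>\<^sup>+x. indicator (\<Union>i\<in>I. X i) x \<partial>M)"
    using m by simp
  also have "\<dots> \<le> (\<integral>\<^sup>+x. \<integral>\<^sup>+i. indicator (X i) x \<partial>count_space I \<partial>M)"
  proof (rule nn_integral_mono)
    fix x
    show "indicator (\<Union>i\<in>I. X i) x \<le> (\<integral>\<^sup>+i. indicator (X i) x \<partial>count_space I)"
    proof (cases "x \<in> (\<Union>i\<in>I. X i)")
      case True
      then obtain i where i: "i \<in> I" "x \<in> X i" by auto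
      have "(indicator (X i) x :: ennreal) \<le> (\<integral>\<^sup>+i. indicator (X i) x \<partial>count_space I)"
        using i(1) by (rule nn_integral_ge_point)
      with i True show ?thesis by simp
    qed simp
  qed
  also have "\<dots> = (\<integral>\<^sup>+i. \<integral>\<^sup>+x. indicator (X i) x \<partial>M \<partial>count_space I)"
    using assms by (intro nn_integral_count_space_nn_integral) auto
  also have "\<dots> = (\<integral>\<^sup>+i. emeasure M (X i) \<partial>count_space I)"
    using X by (intro nn_integral_cong) simp
  finally show ?thesis .
qed

section \<open>Hausdorff contents and measures\<close>

lemma hausdorff_content_le:
  assumes "countable C" "\<And>p. p \<in> C \<Longrightarrow> 0 < snd p \<and> snd p \<le> \<rho>"
    and "F \<subseteq> (\<Union>p\<in>C. cball (fst p) (snd p))"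
  shows "hausdorff_content f \<rho> F \<le> (\<integral>\<^sup>+p. ennreal (f (snd p)) \<partial>count_space C)"
proof -
  have "hausdorff_content f \<rho> F \<le> (\<Sum>\<^sub>\<infinity>(x, r)\<in>C. ennreal (f r))"
    unfolding hausdorff_content_def using assms by (intro INF_lower) (auto simp: case_prod_beta)
  also have "\<dots> = (\<integral>\<^sup>+p. ennreal (f (snd p)) \<partial>count_space C)"
    using infsum_ennreal_eq_nn_integral[OF assms(1)] by (simp add: case_prod_beta)
  finally show ?thesis .
qed

lemma hausdorff_content_less_obtains:
  assumes "hausdorff_content f \<rho> F < M"
  obtains C where "countable C" "\<And>p. p \<in> C \<Longrightarrow> 0 < snd p \<and> snd p \<le> \<rho>"
    "F \<subseteq> (\<Union>p\<in>C. cball (fst p) (snd p))"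
    "(\<integral>\<^sup>+p. ennreal (f (snd p)) \<partial>count_space C) < M"
proof -
  from assms obtain C where C: "countable C" "\<forall>(x, r)\<in>C. 0 < r \<and> r \<le> \<rho>"
      "F \<subseteq> (\<Union>(x, r)\<in>C. cball x r)" "infsum (\<lambda>(x, r). ennreal (f r)) C < M"
    unfolding hausdorff_content_def INF_less_iff by blast
  show thesis
  proof (rule that[OF C(1)])
    show "F \<subseteq> (\<Union>p\<in>C. cball (fst p) (snd p))" using C(3) by (simp add: case_prod_beta)
    show "(\<integral>\<^sup>+p. ennreal (f (snd p)) \<partial>count_space C) < M"
      using C(4) infsum_ennreal_eq_nn_integral[OF C(1), of "\<lambda>p. ennreal (f (snd p))"]
      by (simp add: case_prod_beta')
  qed (use C(2) in auto)
qed

lemma hausdorff_measure_mono: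
  assumes "E \<subseteq> F"
  shows "hausdorff_measure f E \<le> hausdorff_measure f F"
  unfolding hausdorff_measure_def hausdorff_content_def
  using assms by (intro SUP_mono' INF_superset_mono) auto

lemma hausdorff_content_le_measure:
  "0 < \<rho> \<Longrightarrow> hausdorff_content f \<rho> F \<le> hausdorff_measure f F"
  unfolding hausdorff_measure_def by (intro SUP_upper) auto

lemma nn_integral_count_space_Un_le:
  "(\<integral>\<^sup>+x. g x \<partial>count_space (A \<union> B)) \<le> (\<integral>\<^sup>+x. g x \<partial>count_space A) + (\<integral>\<^sup>+x. g x \<partial>count_space B)"
proof -
  have c: "(\<integral>\<^sup>+x. g x \<partial>count_space Y) = (\<integral>\<^sup>+x. g x * indicator Y x \<partial>count_space UNIV)" for Y
    by (auto simp: nn_integral_restrict_space[symmetric] restrict_count_space)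
  show ?thesis
    unfolding c by (subst nn_integral_add[symmetric]) (auto intro!: nn_integral_mono split: split_indicator)
qed

lemma hausdorff_content_Un_null:
  assumes null: "hausdorff_content f \<rho> F = 0"
  shows "hausdorff_content f \<rho> (E \<union> F) \<le> hausdorff_content f \<rho> E"
proof (rule ennreal_le_epsilon)
  fix e :: real
  assume fin: "hausdorff_content f \<rho> E < top" and e: "0 < e"
  obtain C where C: "countable C" "\<And>p. p \<in> C \<Longrightarrow> 0 < snd p \<and> snd p \<le> \<rho>"
      "E \<subseteq> (\<Union>p\<in>C. cball (fst p) (snd p))"
      "(\<integral>\<^sup>+p. ennreal (f (snd p)) \<partial>count_space C) < hausdorff_content f \<rho> E + ennreal (e / 2)"
  proof (rule hausdorff_content_less_obtains[of f \<rho> E])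
    show "hausdorff_content f \<rho> E < hausdorff_content f \<rho> E + ennreal (e / 2)"
      using fin e ennreal_add_left_cancel_less[of "hausdorff_content f \<rho> E" 0 "ennreal (e / 2)"] by auto
  qed (use that in blast)
  obtain D where D: "countable D" "\<And>p. p \<in> D \<Longrightarrow> 0 < snd p \<and> snd p \<le> \<rho>"
      "F \<subseteq> (\<Union>p\<in>D. cball (fst p) (snd p))"
      "(\<integral>\<^sup>+p. ennreal (f (snd p)) \<partial>count_space D) < ennreal (e / 2)"
    by (rule hausdorff_content_less_obtains[of f \<rho> F "ennreal (e / 2)"]) (use null e in auto)
  have "hausdorff_content f \<rho> (E \<union> F) \<le> (\<integral>\<^sup>+p. ennreal (f (snd p)) \<partial>count_space (C \<union> D))"
    using C D by (intro hausdorff_content_le) auto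
  also have "\<dots> \<le> (\<integral>\<^sup>+p. ennreal (f (snd p)) \<partial>count_space C) + (\<integral>\<^sup>+p. ennreal (f (snd p)) \<partial>count_space D)"
    by (rule nn_integral_count_space_Un_le)
  also have "\<dots> \<le> (hausdorff_content f \<rho> E + ennreal (e / 2)) + ennreal (e / 2)"
    using C(4) D(4) by (intro add_mono less_imp_le)
  also have "\<dots> = hausdorff_content f \<rho> E + ennreal e"
    using e by (simp add: add.assoc ennreal_plus[symmetric] del: ennreal_plus)
  finally show "hausdorff_content f \<rho> (E \<union> F) \<le> hausdorff_content f \<rho> E + ennreal e" .
qed

section \<open>Covers by balls as measures\<close>

text \<open>
  The balls, given as pairs of centre and radius, that meet \<open>D\<close>.
\<close>

definition touching :: "'a::metric_space set \<Rightarrow> ('a \<times> real) set" where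
  "touching D = {p. cball (fst p) (snd p) \<inter> D \<noteq> {}}"

text \<open>
  For a cover \<open>C\<close>, the measure on the set of all balls that gives each member of \<open>C\<close> of
  radius \<open>s\<close> the mass \<open>f s\<close>. Its total mass is the sum that occurs in the definition of the
  Hausdorff content, and additivity and continuity from above of this measure replace
  manipulations of subfamilies and tails of that sum.
\<close>

definition cover_weight :: "(real \<Rightarrow> real) \<Rightarrow> ('a \<times> real) set \<Rightarrow> ('a \<times> real) measure" where
  "cover_weight f C = density (count_space UNIV) (\<lambda>p. ennreal (f (snd p)) * indicator C p)"

lemma sets_cover_weight [simp, measurable_cong]: "sets (cover_weight f C) = UNIV"
  by (simp add: cover_weight_def)

lemma emeasure_cover_weight:
  "emeasure (cover_weight f C) A = (\<integral>\<^sup>+p. ennreal (f (snd p)) \<partial>count_space (C \<inter> A))"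
proof -
  have "emeasure (cover_weight f C) A
      = (\<integral>\<^sup>+p. ennreal (f (snd p)) * indicator C p * indicator A p \<partial>count_space UNIV)"
    unfolding cover_weight_def by (subst emeasure_density) auto
  also have "\<dots> = (\<integral>\<^sup>+p. ennreal (f (snd p)) * indicator (C \<inter> A) p \<partial>count_space UNIV)"
    by (intro nn_integral_cong) (auto split: split_indicator)
  also have "\<dots> = (\<integral>\<^sup>+p. ennreal (f (snd p)) \<partial>count_space (C \<inter> A))"
    by (auto simp: nn_integral_restrict_space[symmetric] restrict_count_space)
  finally show ?thesis .
qed

lemma cover_weight_ge:
  assumes "p \<in> C" "p \<in> A"
  shows "ennreal (f (snd p)) \<le> emeasure (cover_weight f C) A"
  unfolding emeasure_cover_weight using assms
  by (intro nn_integral_ge_point[of p "C \<inter> A" "\<lambda>p. ennreal (f (snd p))"]) auto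

text \<open>
  Since \<open>f s / s ^ k\<close> is nonincreasing, a family of balls of radii at most \<open>\<rho>\<close> whose mass is
  small compared with \<open>f \<rho>\<close> has total volume small compared with \<open>\<rho> ^ k\<close>.
\<close>

lemma volume_le_weight:
  fixes f :: "real \<Rightarrow> real"
  assumes anti: "antimono_on {0<..} (\<lambda>s. f s / s ^ k)"
    and rad: "\<And>p. p \<in> C \<inter> A \<Longrightarrow> 0 < snd p \<and> snd p \<le> \<rho>"
    and pos: "0 < \<rho>" "0 < f \<rho>" "0 < x"
    and weight: "emeasure (cover_weight f C) A < ennreal x"
    and le: "\<rho> ^ k / f \<rho> * x \<le> y"
  shows "(\<integral>\<^sup>+p. ennreal (snd p ^ k) \<partial>count_space (C \<inter> A)) < ennreal y"
proof -
  let ?b = "\<rho> ^ k / f \<rho>"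
  have b: "0 < ?b" using pos by simp
  have "(\<integral>\<^sup>+p. ennreal (snd p ^ k) \<partial>count_space (C \<inter> A))
      \<le> (\<integral>\<^sup>+p. ennreal ?b * ennreal (f (snd p)) \<partial>count_space (C \<inter> A))"
  proof (rule nn_integral_mono)
    fix p assume "p \<in> space (count_space (C \<inter> A))"
    then have p: "0 < snd p" "snd p \<le> \<rho>" using rad by auto
    have "f \<rho> / \<rho> ^ k \<le> f (snd p) / snd p ^ k"
      using anti p unfolding monotone_on_def by (metis greaterThan_iff order_less_le_trans)
    then have "snd p ^ k \<le> ?b * f (snd p)"
      using p pos by (simp add: field_simps)
    then show "ennreal (snd p ^ k) \<le> ennreal ?b * ennreal (f (snd p))"
      using b by (simp add: ennreal_mult'[symmetric] ennreal_leI)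
  qed
  also have "\<dots> = ennreal ?b * emeasure (cover_weight f C) A"
    by (simp add: nn_integral_cmult emeasure_cover_weight)
  also have "\<dots> < ennreal ?b * ennreal x"
    using b weight by (intro ennreal_mult_strict_left_mono) auto
  also have "\<dots> = ennreal (?b * x)" using b pos by (simp add: ennreal_mult''[symmetric])
  also have "\<dots> \<le> ennreal y" using le by (rule ennreal_leI)
  finally show ?thesis .
qed

section \<open>Mass transference\<close>

text \<open>
  Let \<open>C\<close> be a family of balls of finite mass, and suppose that the members of \<open>C\<close> that meet the
  ball \<open>D\<close> with centre \<open>z\<close> and radius \<open>t\<close> have small total volume compared with \<open>D\<close>. Suppose that
  almost every point of \<open>D\<close> lies in infinitely many of the large balls, of radius \<open>R i\<close>. Then some
  small ball inside \<open>D\<close>, of radius \<open>r i\<close>, is met only by members of \<open>C\<close> of total mass less than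
  \<open>e * f (r i)\<close>.

  Otherwise every small ball inside \<open>D\<close> is heavy. Let \<open>V\<close> be half of \<open>D\<close> without the threefold
  enlargements of the members of \<open>C\<close> that meet \<open>D\<close>; it has positive volume. If a large ball with
  radius \<open>R i < \<rho>\<close> contains a point of \<open>V\<close>, then the members of \<open>C\<close> that meet its small ball all
  have radius less than \<open>R i\<close>, hence have their centres in the large ball of radius \<open>2 * R i\<close>. Vitali's
  lemma selects such large balls, disjoint after doubling, that carry a fixed
  proportion of the volume of \<open>V\<close>. Their small balls are met by disjoint families of members of \<open>C\<close>,
  all of radius less than \<open>\<rho>\<close>, and by heaviness these families have total mass at least a constant
  independent of \<open>\<rho>\<close>. This is absurd, because the mass of the members of \<open>C\<close> of radius less than \<open>\<rho>\<close> tends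
  to \<open>0\<close> with \<open>\<rho>\<close>.
\<close>

lemma mass_transference_step:
  fixes c :: "'i \<Rightarrow> 'a::euclidean_space" and q :: "'i \<Rightarrow> nat"
  assumes C: "countable C" "\<And>p. p \<in> C \<Longrightarrow> 0 < snd p"
    and finite_weight: "emeasure (cover_weight f C) UNIV < \<infinity>"
    and fpos: "\<And>s. 0 < s \<Longrightarrow> 0 < f s"
    and I: "\<And>i. i \<in> I \<Longrightarrow> 0 < r i \<and> r i \<le> R i \<and> R i ^ DIM('a) \<le> K * f (r i)" and K: "0 < K"
    and small: "\<And>\<rho>. 0 < \<rho> \<Longrightarrow> \<exists>N. \<forall>i\<in>I. N \<le> q i \<longrightarrow> R i < \<rho>"
    and ae: "\<And>N. AE x in lborel. x \<in> cball z t \<longrightarrow> (\<exists>i\<in>I. N \<le> q i \<and> x \<in> cball (c i) (R i))"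
    and t: "0 < t"
    and light: "(\<integral>\<^sup>+p. ennreal (snd p ^ DIM('a)) \<partial>count_space (C \<inter> touching (cball z t)))
                  < ennreal ((t / 6) ^ DIM('a))"
    and e: "0 < e"
  shows "\<exists>i\<in>I. N \<le> q i \<and> cball (c i) (r i) \<subseteq> cball z t \<and>
           emeasure (cover_weight f C) (touching (cball (c i) (r i))) < ennreal (e * f (r i))"
proof (rule ccontr)
  define k where "k = DIM('a)"
  define u where "u = unit_ball_vol (real k)"
  define \<nu> where "\<nu> = cover_weight f C"
  define C' where "C' = C \<inter> touching (cball z t)"
  define U where "U = (\<Union>p\<in>C'. cball (fst p) (3 * snd p))"
  \<comment> \<open>Half of the ball: large balls of radius at most \<open>t / 4\<close> that meet \<open>V\<close> stay inside \<open>cball z t\<close>.\<close>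
  define V where "V = ball z (t / 2) - U"
  define T where "T i = C \<inter> touching (cball (c i) (r i))" for i
  have k: "0 < k" by (simp add: k_def)
  have u: "0 < u" by (simp add: u_def unit_ball_vol_pos)
  have C': "countable C'" using C(1) by (auto simp: C'_def)
  have sets_\<nu>: "A \<in> sets \<nu>" for A by (simp add: \<nu>_def)
  have \<nu>_C: "emeasure \<nu> (C \<inter> A) = emeasure \<nu> A" for A
    by (simp add: \<nu>_def emeasure_cover_weight Int_assoc[symmetric])
  assume neg: "\<not> ?thesis"
  have heavy: "ennreal (e * f (r i)) \<le> emeasure \<nu> (T i)"
    if "i \<in> I" "N \<le> q i" "cball (c i) (r i) \<subseteq> cball z t" for i
    using neg that unfolding T_def \<nu>_C by (auto simp: \<nu>_def not_less)
  have vol: "emeasure lborel (cball x s :: 'a set) = ennreal (u * s ^ k)" if "0 \<le> s" for x s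
    using emeasure_cball[OF that, of x] by (simp add: u_def k_def)
  have U_sets: "U \<in> sets borel"
    unfolding U_def using C' by (intro sets.countable_UN') auto
  have U_less: "emeasure lborel U < emeasure lborel (ball z (t / 2))"
  proof -
    have "emeasure lborel U \<le> (\<integral>\<^sup>+p. emeasure lborel (cball (fst p) (3 * snd p)) \<partial>count_space C')"
      unfolding U_def using C' by (intro emeasure_UN_countable_le) auto
    also have "\<dots> = (\<integral>\<^sup>+p. ennreal (u * 3 ^ k) * ennreal (snd p ^ k) \<partial>count_space C')"
    proof (rule nn_integral_cong)
      fix p assume "p \<in> space (count_space C')"
      then have "0 < snd p" using C(2) by (auto simp: C'_def)
      then show "emeasure lborel (cball (fst p) (3 * snd p)) = ennreal (u * 3 ^ k) * ennreal (snd p ^ k)"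
        using u by (simp add: vol power_mult_distrib ennreal_mult'[symmetric] mult.assoc)
    qed
    also have "\<dots> = ennreal (u * 3 ^ k) * (\<integral>\<^sup>+p. ennreal (snd p ^ k) \<partial>count_space C')"
      by (simp add: nn_integral_cmult)
    also have "\<dots> < ennreal (u * 3 ^ k) * ennreal ((t / 6) ^ k)"
      using u light by (intro ennreal_mult_strict_left_mono) (auto simp: C'_def k_def)
    also have "\<dots> = ennreal (u * (t / 2) ^ k)"
    proof -
      have "3 ^ k * (t / 6) ^ k = (t / 2) ^ k" by (simp flip: power_mult_distrib)
      then show ?thesis using u t by (simp add: ennreal_mult''[symmetric] mult.assoc)
    qed
    also have "\<dots> = emeasure lborel (ball z (t / 2))"
      using t emeasure_ball[of "t / 2" z] by (simp add: u_def k_def)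
    finally show ?thesis .
  qed
  have V_sets: "V \<in> sets borel" unfolding V_def using U_sets by auto
  have V_pos: "0 < emeasure lborel V"
  proof (rule ccontr)
    assume "\<not> ?thesis"
    then have V0: "emeasure lborel V = 0" by simp
    have "emeasure lborel (ball z (t / 2)) \<le> emeasure lborel (V \<union> U)"
      using V_sets U_sets by (intro emeasure_mono) (auto simp: V_def)
    also have "\<dots> \<le> emeasure lborel V + emeasure lborel U"
      using V_sets U_sets by (intro emeasure_subadditive) auto
    finally show False using V0 U_less by simp
  qed
  define A where "A = u * 10 ^ k * K / e"
  have A: "0 < A" using u K e by (simp add: A_def)
  have tail: "emeasure lborel V \<le> ennreal A * emeasure \<nu> {p \<in> C. snd p < \<rho>}" if "0 < \<rho>" for \<rho>
  proof -
    define \<rho>' where "\<rho>' = min \<rho> (t / 4)"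
    have \<rho>': "0 < \<rho>'" "\<rho>' \<le> \<rho>" "\<rho>' \<le> t / 4" using that t by (auto simp: \<rho>'_def)
    obtain N1 where N1: "\<forall>i\<in>I. N1 \<le> q i \<longrightarrow> R i < \<rho>'" using small[OF \<rho>'(1)] by blast
    define N2 where "N2 = max N N1"
    define X where "X = {i\<in>I. N2 \<le> q i \<and> (\<exists>y\<in>V. y \<in> cball (c i) (R i))}"
    have X: "i \<in> I" "N \<le> q i" "R i < \<rho>'" "0 < r i" "r i \<le> R i" "0 < R i" "R i ^ k \<le> K * f (r i)"
      if "i \<in> X" for i
      using that I[of i] N1 by (auto simp: X_def N2_def k_def)
    have sub: "cball (c i) (r i) \<subseteq> cball z t" if i: "i \<in> X" for i
    proof
      fix w assume w: "w \<in> cball (c i) (r i)"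
      from i obtain y where y: "y \<in> V" "dist (c i) y \<le> R i" by (auto simp: X_def)
      have "dist z w \<le> dist z y + dist (c i) y + dist (c i) w"
        by (smt (verit) dist_commute dist_triangle)
      moreover have "dist z y < t / 2" using y(1) by (auto simp: V_def)
      ultimately show "w \<in> cball z t"
        using w y(2) X(3,5)[OF i] \<rho>'(3) by auto
    qed
    have T: "snd p < R i \<and> dist (c i) (fst p) \<le> 2 * R i" if i: "i \<in> X" and p: "p \<in> T i" for i p
    proof -
      from p obtain w where w: "p \<in> C" "dist (fst p) w \<le> snd p" "dist (c i) w \<le> r i"
        by (auto simp: T_def touching_def)
      from i obtain y where y: "y \<in> V" "dist (c i) y \<le> R i" by (auto simp: X_def)
      have "p \<in> C'"
        using w subsetD[OF sub[OF i], of w] by (auto simp: C'_def touching_def)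
      then have "3 * snd p < dist (fst p) y"
        using y(1) by (auto simp: V_def U_def not_le)
      moreover have "dist (fst p) y \<le> dist (fst p) w + dist (c i) w + dist (c i) y"
        by (smt (verit) dist_commute dist_triangle)
      ultimately have less: "snd p < R i" using w y(2) X(5)[OF i] by linarith
      have "dist (c i) (fst p) \<le> dist (fst p) w + dist (c i) w"
        by (smt (verit) dist_commute dist_triangle)
      with less show ?thesis using w X(5)[OF i] by linarith
    qed
    \<comment> \<open>Doubled radii, because the members of \<open>T i\<close> have centres within \<open>2 * R i\<close> of \<open>c i\<close>.\<close>
    obtain X0 where X0: "countable X0" "X0 \<subseteq> X"
        "pairwise (\<lambda>i j. disjnt (cball (c i) (2 * R i)) (cball (c j) (2 * R j))) X0"
        "V \<inter> (\<Union>i\<in>X. cball (c i) (R i)) \<subseteq> (\<Union>i\<in>X0. cball (c i) (5 * (2 * R i)))"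
    proof (rule Vitali_covering_lemma_cballs)
      show "V \<inter> (\<Union>i\<in>X. cball (c i) (R i)) \<subseteq> (\<Union>i\<in>X. cball (c i) (2 * R i))"
      proof -
        have "cball (c i) (R i) \<subseteq> cball (c i) (2 * R i)" if "i \<in> X" for i
          using X(6)[OF that] by (intro subset_cball) simp
        then show ?thesis by blast
      qed
      show "0 < 2 * R i \<and> 2 * R i \<le> 2 * \<rho>'" if "i \<in> X" for i
        using X[OF that] by simp
    qed (use that in blast)
    have "emeasure lborel V \<le> emeasure lborel (\<Union>i\<in>X0. cball (c i) (5 * (2 * R i)))"
    proof (rule emeasure_mono_AE)
      show "AE x in lborel. x \<in> V \<longrightarrow> x \<in> (\<Union>i\<in>X0. cball (c i) (5 * (2 * R i)))"
        using ae[of N2]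
      proof eventually_elim
        case (elim x)
        show ?case
        proof
          assume x: "x \<in> V"
          then have "x \<in> cball z t" using t by (auto simp: V_def)
          with elim obtain i where "i \<in> I" "N2 \<le> q i" "x \<in> cball (c i) (R i)" by auto
          then have "x \<in> V \<inter> (\<Union>i\<in>X. cball (c i) (R i))" using x by (auto simp: X_def)
          then show "x \<in> (\<Union>i\<in>X0. cball (c i) (5 * (2 * R i)))" using X0(4) by blast
        qed
      qed
      have "(\<Union>i\<in>X0. cball (c i) (5 * (2 * R i))) \<in> sets borel"
        using X0(1) by (intro sets.countable_UN') auto
      then show "(\<Union>i\<in>X0. cball (c i) (5 * (2 * R i))) \<in> sets lborel" by simp
    qed
    also have "\<dots> \<le> (\<integral>\<^sup>+i. emeasure lborel (cball (c i) (5 * (2 * R i))) \<partial>count_space X0)"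
      using X0(1) by (intro emeasure_UN_countable_le) auto
    also have "\<dots> \<le> (\<integral>\<^sup>+i. ennreal A * emeasure \<nu> (T i) \<partial>count_space X0)"
    proof (rule nn_integral_mono)
      fix i assume "i \<in> space (count_space X0)"
      then have i: "i \<in> X" using X0(2) by auto
      have "u * (10 * R i) ^ k = u * 10 ^ k * R i ^ k" by (simp add: power_mult_distrib)
      also have "\<dots> \<le> u * 10 ^ k * (K * f (r i))" using u X(7)[OF i] by (intro mult_left_mono) auto
      also have "\<dots> = A * (e * f (r i))" using e by (simp add: A_def field_simps)
      finally have "ennreal (u * (10 * R i) ^ k) \<le> ennreal A * ennreal (e * f (r i))"
        using A by (simp add: ennreal_mult'[symmetric] ennreal_leI)
      also have "\<dots> \<le> ennreal A * emeasure \<nu> (T i)"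
        using heavy[OF X(1,2) sub] i by (intro mult_left_mono) auto
      finally show "emeasure lborel (cball (c i) (5 * (2 * R i))) \<le> ennreal A * emeasure \<nu> (T i)"
        using X(6)[OF i] by (simp add: vol)
    qed
    also have "\<dots> = ennreal A * (\<integral>\<^sup>+i. emeasure \<nu> (T i) \<partial>count_space X0)"
      by (simp add: nn_integral_cmult)
    also have "(\<integral>\<^sup>+i. emeasure \<nu> (T i) \<partial>count_space X0) = emeasure \<nu> (\<Union>i\<in>X0. T i)"
    proof (rule emeasure_UN_countable[symmetric])
      show "disjoint_family_on T X0"
        unfolding disjoint_family_on_def
      proof (intro ballI impI)
        fix i j assume ij: "i \<in> X0" "j \<in> X0" "i \<noteq> j"
        with X0(3) have d: "disjnt (cball (c i) (2 * R i)) (cball (c j) (2 * R j))"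
          by (auto simp: pairwise_def)
        have "fst p \<in> cball (c i) (2 * R i) \<inter> cball (c j) (2 * R j)" if "p \<in> T i \<inter> T j" for p
          using T[of i p] T[of j p] that ij X0(2) by auto
        with d show "T i \<inter> T j = {}" unfolding disjnt_def by blast
      qed
    qed (use X0(1) sets_\<nu> in auto)
    also have "emeasure \<nu> (\<Union>i\<in>X0. T i) \<le> emeasure \<nu> {p \<in> C. snd p < \<rho>}"
    proof (rule emeasure_mono)
      show "(\<Union>i\<in>X0. T i) \<subseteq> {p \<in> C. snd p < \<rho>}"
      proof safe
        fix i a s assume i: "i \<in> X0" and p: "(a, s) \<in> T i"
        show "(a, s) \<in> C" using p by (auto simp: T_def)
        show "snd (a, s) < \<rho>" using T[OF _ p] X(3)[of i] i X0(2) \<rho>'(2) by fastforce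
      qed
    qed (rule sets_\<nu>)
    finally show ?thesis by (simp add: mult_left_mono)
  qed
  define Y where "Y n = {p \<in> C. snd p < 1 / real (Suc n)}" for n
  have "(\<lambda>n. emeasure \<nu> (Y n)) \<longlonglongrightarrow> emeasure \<nu> (\<Inter>n. Y n)"
  proof (rule Lim_emeasure_decseq)
    show "decseq Y"
    proof (rule decseq_SucI)
      fix n
      have "1 / real (Suc (Suc n)) \<le> 1 / real (Suc n)" by (intro divide_left_mono) auto
      then show "Y (Suc n) \<subseteq> Y n" by (auto simp: Y_def)
    qed
    show "emeasure \<nu> (Y n) \<noteq> \<infinity>" for n
      using finite_weight emeasure_mono[of "Y n" UNIV \<nu>] sets_\<nu> by (auto simp: \<nu>_def top_unique)
  qed (use sets_\<nu> in auto)
  moreover have "(\<Inter>n. Y n) = {}"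
  proof -
    have False if p: "p \<in> (\<Inter>n. Y n)" for p
    proof -
      have "0 < snd p" using p C(2) by (auto simp: Y_def)
      then obtain n where "1 / real (Suc n) < snd p" using nat_approx_posE by metis
      moreover have "snd p < 1 / real (Suc n)" using p by (auto simp: Y_def)
      ultimately show False by simp
    qed
    then show ?thesis by blast
  qed
  ultimately have "(\<lambda>n. emeasure \<nu> (Y n)) \<longlonglongrightarrow> 0" by simp
  then have "(\<lambda>n. ennreal A * emeasure \<nu> (Y n)) \<longlonglongrightarrow> ennreal A * 0"
    by (intro ennreal_tendsto_cmult) auto
  moreover have "emeasure lborel V \<le> ennreal A * emeasure \<nu> (Y n)" for n
    unfolding Y_def by (rule tail) simp
  ultimately have "emeasure lborel V \<le> ennreal A * 0"
    by (intro LIMSEQ_le_const) auto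
  with V_pos show False by simp
qed

text \<open>
  A special case of the mass transference principle, for balls of infinite \<open>f\<close>-measure. The ball
  with index \<open>i\<close> has small radius \<open>r i\<close> and large radius \<open>R i\<close>, where \<open>R i ^ k\<close> is at most
  a constant times \<open>f (r i)\<close>; a point lies in infinitely many balls in the sense that the
  orders \<open>q i\<close> of those that contain it are unbounded.

  If the limsup set of the small balls had finite measure, it would have covers of bounded mass by
  balls of arbitrarily small radius, hence of arbitrarily small total volume. For such a cover, the preceding lemma
  applies to a fixed ball in \<open>W\<close> and then, with \<open>e = (1 / 6) ^ k\<close>, to each
  small ball that it produces. Iteration gives a nested sequence of small balls whose common point \<open>x\<close> lies in the
  limsup set. A ball of the cover that contains \<open>x\<close> meets all of them, so that its mass is less
  than \<open>f (r i)\<close> for arbitrarily small \<open>r i\<close>, which contradicts \<open>f s \<longrightarrow> 0\<close>.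
\<close>

theorem mass_transference:
  fixes c :: "'i \<Rightarrow> 'a::euclidean_space" and q :: "'i \<Rightarrow> nat"
  assumes dim: "dimension_function f"
    and anti: "antimono_on {0<..} (\<lambda>s. f s / s ^ DIM('a))"
    and unbounded: "\<And>M. \<exists>\<rho>>0. M < f \<rho> / \<rho> ^ DIM('a)"
    and I: "\<And>i. i \<in> I \<Longrightarrow> 0 < r i \<and> r i \<le> R i \<and> R i ^ DIM('a) \<le> K * f (r i)" and K: "0 < K"
    and small: "\<And>\<rho>. 0 < \<rho> \<Longrightarrow> \<exists>N. \<forall>i\<in>I. N \<le> q i \<longrightarrow> R i < \<rho>"
    and W: "open W" "W \<noteq> {}"
    and ae: "\<And>N. AE x in lborel. x \<in> W \<longrightarrow> (\<exists>i\<in>I. N \<le> q i \<and> x \<in> cball (c i) (R i))"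
  shows "hausdorff_measure f {x \<in> W. \<forall>N. \<exists>i\<in>I. N \<le> q i \<and> x \<in> cball (c i) (r i)} = \<infinity>"
proof (rule ccontr)
  define k where "k = DIM('a)"
  define E where "E = {x \<in> W. \<forall>N. \<exists>i\<in>I. N \<le> q i \<and> x \<in> cball (c i) (r i)}"
  assume "\<not> ?thesis"
  then have "hausdorff_measure f E < \<infinity>" by (simp add: E_def top.not_eq_extremum)
  then obtain M :: nat where M: "hausdorff_measure f E < ennreal (real M)"
    unfolding infinity_ennreal_def using ennreal_Ex_less_of_nat by (metis ennreal_of_nat_eq_real_of_nat)
  have fpos: "0 < f s" if "0 < s" for s
    using dim that by (auto simp: dimension_function_def pos_fun_def)
  have fmono: "f s \<le> f s'" if "0 < s" "s \<le> s'" for s s'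
    using dim that unfolding dimension_function_def monotone_on_def by auto
  obtain z where "z \<in> W" using W(2) by blast
  then obtain t where zt: "0 < t" "cball z t \<subseteq> W"
    using W(1) open_contains_cball by blast
  have "0 < real M" using M by (cases "M = 0") auto
  \<comment> \<open>Covers of mass at most \<open>M\<close> by balls of radius at most \<open>\<rho>\<close> have total volume small compared with \<open>cball z t\<close>.\<close>
  obtain \<rho> where \<rho>: "0 < \<rho>" "real M * (6 / t) ^ k < f \<rho> / \<rho> ^ k"
    using unbounded[of "real M * (6 / t) ^ k"] by (auto simp: k_def)
  have "hausdorff_content f \<rho> E < ennreal (real M)"
    using hausdorff_content_le_measure[OF \<rho>(1)] M by (rule order.strict_trans1)
  then obtain C where C: "countable C" "\<And>p. p \<in> C \<Longrightarrow> 0 < snd p \<and> snd p \<le> \<rho>"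
      "E \<subseteq> (\<Union>p\<in>C. cball (fst p) (snd p))"
      "(\<integral>\<^sup>+p. ennreal (f (snd p)) \<partial>count_space C) < ennreal (real M)"
    by (rule hausdorff_content_less_obtains[of f \<rho> E "ennreal (real M)"]) (use that in blast)
  define \<nu> where "\<nu> = cover_weight f C"
  have \<nu>: "emeasure \<nu> UNIV < ennreal (real M)"
    using C(4) by (simp add: \<nu>_def emeasure_cover_weight)
  then have \<nu>_fin: "emeasure \<nu> UNIV < \<infinity>" by (auto intro: order.strict_trans)
  have \<nu>_mono: "emeasure \<nu> A \<le> emeasure \<nu> UNIV" for A
    by (intro emeasure_mono) (auto simp: \<nu>_def)
  define e :: real where "e = (1 / 6) ^ k"
  have e: "0 < e" "e \<le> 1" by (auto simp: e_def power_le_one)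
  define P where "P N i \<longleftrightarrow> i \<in> I \<and> N \<le> q i \<and> cball (c i) (r i) \<subseteq> W \<and>
      emeasure \<nu> (touching (cball (c i) (r i))) < ennreal (e * f (r i))" for N :: nat and i
  have step: "\<exists>i. P N i \<and> cball (c i) (r i) \<subseteq> cball y s"
    if y: "cball y s \<subseteq> W" "0 < s"
      and light: "(\<integral>\<^sup>+p. ennreal (snd p ^ k) \<partial>count_space (C \<inter> touching (cball y s))) < ennreal ((s / 6) ^ k)"
    for N y s
  proof -
    have "\<exists>i\<in>I. N \<le> q i \<and> cball (c i) (r i) \<subseteq> cball y s \<and>
        emeasure (cover_weight f C) (touching (cball (c i) (r i))) < ennreal (e * f (r i))"
    proof (rule mass_transference_step[where R = R and K = K])
      show "AE x in lborel. x \<in> cball y s \<longrightarrow> (\<exists>i\<in>I. N \<le> q i \<and> x \<in> cball (c i) (R i))" for N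
        using ae[of N] y(1) by (auto elim!: eventually_mono)
    qed (use C \<nu>_fin fpos I K small y e light in \<open>auto simp: \<nu>_def k_def\<close>)
    then show ?thesis using y(1) unfolding P_def \<nu>_def by blast
  qed
  have "\<exists>i. P 0 i"
  proof -
    have "(\<integral>\<^sup>+p. ennreal (snd p ^ k) \<partial>count_space (C \<inter> touching (cball z t))) < ennreal ((t / 6) ^ k)"
    proof (rule volume_le_weight[where f = f and \<rho> = \<rho> and x = "real M"])
      show "emeasure (cover_weight f C) (touching (cball z t)) < ennreal (real M)"
        using \<nu> \<nu>_mono by (auto simp: \<nu>_def intro: order.strict_trans1)
      show "\<rho> ^ k / f \<rho> * real M \<le> (t / 6) ^ k"
        using \<rho> fpos[OF \<rho>(1)] zt(1) by (simp add: field_simps)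
    qed (use anti C(2) \<rho>(1) fpos \<open>0 < real M\<close> in \<open>auto simp: k_def\<close>)
    then show ?thesis using step[OF zt(2,1)] by blast
  qed
  moreover have "\<exists>j. P (Suc n) j \<and> cball (c j) (r j) \<subseteq> cball (c i) (r i)" if i: "P n i" for n i
  proof (rule step)
    have r: "0 < r i" using i I by (auto simp: P_def)
    show "cball (c i) (r i) \<subseteq> W" "0 < r i" using i I by (auto simp: P_def)
    show "(\<integral>\<^sup>+p. ennreal (snd p ^ k) \<partial>count_space (C \<inter> touching (cball (c i) (r i)))) < ennreal ((r i / 6) ^ k)"
    proof (rule volume_le_weight[where f = f and \<rho> = "r i" and x = "e * f (r i)"])
      show "emeasure (cover_weight f C) (touching (cball (c i) (r i))) < ennreal (e * f (r i))"
        using i by (simp add: P_def \<nu>_def)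
      show "r i ^ k / f (r i) * (e * f (r i)) \<le> (r i / 6) ^ k"
        using fpos[OF r] by (simp add: e_def power_divide)
      show "0 < snd p \<and> snd p \<le> r i" if p: "p \<in> C \<inter> touching (cball (c i) (r i))" for p
      proof -
        have "ennreal (f (snd p)) < ennreal (e * f (r i))"
          using cover_weight_ge[of p C "touching (cball (c i) (r i))" f] p i
          by (auto simp: P_def \<nu>_def)
        then have "f (snd p) < e * f (r i)" by (meson ennreal_leI not_less)
        also have "\<dots> \<le> f (r i)" using e fpos[OF r] by (simp add: mult_le_cancel_right1)
        finally have "snd p < r i" using fmono[OF r] by (meson not_less)
        then show ?thesis using C(2) p by auto
      qed
    qed (use anti e fpos r in \<open>auto simp: k_def\<close>)
  qed
  ultimately obtain s where s: "\<And>n. P n (s n)"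
      "\<And>n. cball (c (s (Suc n))) (r (s (Suc n))) \<subseteq> cball (c (s n)) (r (s n))"
    using dependent_nat_choice[of P "\<lambda>n i j. cball (c j) (r j) \<subseteq> cball (c i) (r i)"] by blast
  define F where "F n = cball (c (s n)) (r (s n))" for n
  have "\<Inter> (range F) \<noteq> {}"
  proof (rule compact_nest)
    show "compact (F n)" for n by (simp add: F_def)
    show "F n \<noteq> {}" for n using s(1)[of n] I[of "s n"] by (auto simp: P_def F_def)
    have "F (Suc n) \<subseteq> F n" for n unfolding F_def by (rule s(2))
    then show "F n \<subseteq> F m" if "m \<le> n" for m n
      using that by (rule lift_Suc_antimono_le)
  qed
  then obtain x where "x \<in> \<Inter> (range F)" by blast
  then have x: "x \<in> cball (c (s n)) (r (s n))" for n unfolding F_def by blast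
  have "x \<in> W" using x[of 0] s(1)[of 0] by (auto simp: P_def)
  moreover have "\<exists>i\<in>I. N \<le> q i \<and> x \<in> cball (c i) (r i)" for N
    using x[of N] s(1)[of N] by (auto simp: P_def)
  ultimately have "x \<in> E" by (simp add: E_def)
  then obtain p where p: "p \<in> C" "x \<in> cball (fst p) (snd p)" using C(3) by auto
  have "eventually (\<lambda>y. f y < f (snd p)) (at_right 0)"
    using dim fpos C(2)[OF p(1)] by (auto simp: dimension_function_def intro: order_tendstoD)
  then obtain d where d: "0 < d" "\<And>y. 0 < y \<Longrightarrow> y < d \<Longrightarrow> f y < f (snd p)"
    by (auto simp: eventually_at_right_field)
  obtain N where N: "\<forall>i\<in>I. N \<le> q i \<longrightarrow> R i < d" using small[OF d(1)] by blast
  define i where "i = s N"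
  have i: "i \<in> I" "N \<le> q i" "emeasure \<nu> (touching (cball (c i) (r i))) < ennreal (e * f (r i))"
    using s(1)[of N] by (auto simp: P_def i_def)
  have r: "0 < r i" "r i < d" using I[OF i(1)] N i by force+
  have "p \<in> touching (cball (c i) (r i))" using p(2) x[of N] by (auto simp: touching_def i_def)
  then have "ennreal (f (snd p)) < ennreal (e * f (r i))"
    using cover_weight_ge[of p C "touching (cball (c i) (r i))" f] p(1) i(3) by (auto simp: \<nu>_def)
  then have "f (snd p) < e * f (r i)" by (meson ennreal_leI not_less)
  also have "\<dots> \<le> f (r i)" using e fpos[OF r(1)] by (simp add: mult_le_cancel_right1)
  finally show False using d(2)[OF r] by simp
qed

section \<open>Lebesgue null sets\<close>

lemma lebesgue_null_cover:
  fixes F :: "'a::euclidean_space set"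
  assumes "F \<in> null_sets lebesgue" "0 < \<rho>" "0 < e"
  obtains C where "countable C" "\<And>p. p \<in> C \<Longrightarrow> 0 < snd p \<and> snd p \<le> \<rho>"
    "F \<subseteq> (\<Union>p\<in>C. cball (fst p) (snd p))"
    "(\<integral>\<^sup>+p. ennreal (snd p ^ DIM('a)) \<partial>count_space C) \<le> ennreal e"
proof -
  define k where "k = DIM('a)"
  define u where "u = unit_ball_vol (real k)"
  have u: "0 < u" by (simp add: u_def unit_ball_vol_pos)
  define d where "d = e * u / 5 ^ k"
  have d: "0 < d" using assms u by (simp add: d_def)
  have "F \<in> lmeasurable" using assms(1) by (auto simp: fmeasurable_def null_sets_def)
  then obtain U where U: "open U" "F \<subseteq> U" "U - F \<in> lmeasurable" "emeasure lebesgue (U - F) < ennreal d"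
    using sets_lebesgue_outer_open[of F d] d by (auto simp: fmeasurable_def)
  have "emeasure lebesgue U \<le> emeasure lebesgue (U - F) + emeasure lebesgue F"
    using U assms(1) by (intro order_trans[OF _ emeasure_subadditive] emeasure_mono) auto
  also have "\<dots> \<le> ennreal d" using U(4) assms(1) by (auto simp: null_sets_def)
  finally have U_le: "emeasure lborel U \<le> ennreal d" using U(1) by simp
  have "\<exists>s. 0 < s \<and> s \<le> \<rho> / 5 \<and> ball x s \<subseteq> U" if "x \<in> F" for x
  proof -
    have "x \<in> U" using U(2) that by blast
    with U(1) obtain s where "0 < s" "ball x s \<subseteq> U" by (rule openE)
    then show ?thesis using assms(2) by (intro exI[of _ "min s (\<rho> / 5)"]) auto
  qed
  then obtain s where s: "\<And>x. x \<in> F \<Longrightarrow> 0 < s x \<and> s x \<le> \<rho> / 5 \<and> ball x (s x) \<subseteq> U"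
    using bchoice[of F "\<lambda>x s. 0 < s \<and> s \<le> \<rho> / 5 \<and> ball x s \<subseteq> U"] by blast
  obtain X where X: "countable X" "X \<subseteq> F" "pairwise (\<lambda>i j. disjnt (ball i (s i)) (ball j (s j))) X"
      "F \<subseteq> (\<Union>i\<in>X. ball i (5 * s i))"
  proof (rule Vitali_covering_lemma_balls[where S = F and K = F and a = "\<lambda>x. x" and r = s])
    show "F \<subseteq> (\<Union>x\<in>F. ball x (s x))" using s by auto
    show "0 < s i \<and> s i \<le> \<rho> / 5" if "i \<in> F" for i using s[OF that] by simp
  qed (use that in blast)
  define C where "C = (\<lambda>x. (x, 5 * s x)) ` X"
  have inj: "inj_on (\<lambda>x. (x, 5 * s x)) X" by (auto simp: inj_on_def)
  show thesis
  proof (rule that)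
    show "countable C" using X by (simp add: C_def)
    show "0 < snd p \<and> snd p \<le> \<rho>" if "p \<in> C" for p
      using that X(2) s by (fastforce simp: C_def)
    show "F \<subseteq> (\<Union>p\<in>C. cball (fst p) (snd p))"
    proof
      fix x assume "x \<in> F"
      with X(4) obtain i where "i \<in> X" "x \<in> ball i (5 * s i)" by blast
      then show "x \<in> (\<Union>p\<in>C. cball (fst p) (snd p))"
        unfolding C_def by (intro UN_I[of "(i, 5 * s i)"]) auto
    qed
    have "(\<integral>\<^sup>+p. ennreal (snd p ^ DIM('a)) \<partial>count_space C)
        = (\<integral>\<^sup>+x. ennreal ((5 * s x) ^ k) \<partial>count_space X)"
      using nn_integral_bij_count_space[OF inj_on_imp_bij_betw[OF inj], of "\<lambda>p. ennreal (snd p ^ k)"]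
      by (simp add: C_def k_def)
    also have "\<dots> = (\<integral>\<^sup>+x. ennreal (5 ^ k / u) * emeasure lborel (ball x (s x)) \<partial>count_space X)"
    proof (rule nn_integral_cong)
      fix x assume "x \<in> space (count_space X)"
      then have "0 \<le> s x" using X(2) s by force
      then have "emeasure lborel (ball x (s x)) = ennreal (u * s x ^ k)"
        using emeasure_ball[of "s x" x] by (simp add: u_def k_def)
      then show "ennreal ((5 * s x) ^ k) = ennreal (5 ^ k / u) * emeasure lborel (ball x (s x))"
        using u by (simp add: ennreal_mult'[symmetric] power_mult_distrib)
    qed
    also have "\<dots> = ennreal (5 ^ k / u) * (\<integral>\<^sup>+x. emeasure lborel (ball x (s x)) \<partial>count_space X)"
      by (simp add: nn_integral_cmult)
    also have "(\<integral>\<^sup>+x. emeasure lborel (ball x (s x)) \<partial>count_space X) = emeasure lborel (\<Union>x\<in>X. ball x (s x))"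
      using X(1,3) by (intro emeasure_UN_countable[symmetric])
        (auto simp: disjoint_family_on_def pairwise_def disjnt_def)
    also have "\<dots> \<le> emeasure lborel U"
      using s X(2) U(1) by (intro emeasure_mono) auto
    also have "\<dots> \<le> ennreal d" by (rule U_le)
    also have "ennreal (5 ^ k / u) * ennreal d = ennreal e"
      using u d by (simp add: ennreal_mult''[symmetric] d_def)
    finally show "(\<integral>\<^sup>+p. ennreal (snd p ^ DIM('a)) \<partial>count_space C) \<le> ennreal e"
      by (simp add: mult_left_mono)
  qed
qed

lemma hausdorff_measure_diff_null:
  fixes E F :: "'a::euclidean_space set"
  assumes bound: "\<And>s. 0 < s \<Longrightarrow> s \<le> 1 \<Longrightarrow> f s \<le> B * s ^ DIM('a)"
    and "F - E \<in> null_sets lebesgue"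
  shows "hausdorff_measure f F \<le> hausdorff_measure f E"
proof -
  have B: "0 < max B 1" by simp
  have null: "hausdorff_content f \<rho> (F - E) = 0" if \<rho>: "0 < \<rho>" for \<rho>
  proof -
    have "hausdorff_content f \<rho> (F - E) \<le> 0 + ennreal e" if e: "0 < e" for e
    proof -
      obtain C where C: "countable C" "\<And>p. p \<in> C \<Longrightarrow> 0 < snd p \<and> snd p \<le> min \<rho> 1"
          "F - E \<subseteq> (\<Union>p\<in>C. cball (fst p) (snd p))"
          "(\<integral>\<^sup>+p. ennreal (snd p ^ DIM('a)) \<partial>count_space C) \<le> ennreal (e / max B 1)"
        using lebesgue_null_cover[OF assms(2), of "min \<rho> 1" "e / max B 1"] \<rho> e B by auto
      have "hausdorff_content f \<rho> (F - E) \<le> (\<integral>\<^sup>+p. ennreal (f (snd p)) \<partial>count_space C)"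
        using C by (intro hausdorff_content_le) auto
      also have "\<dots> \<le> (\<integral>\<^sup>+p. ennreal (max B 1) * ennreal (snd p ^ DIM('a)) \<partial>count_space C)"
      proof (rule nn_integral_mono)
        fix p assume "p \<in> space (count_space C)"
        then have p: "0 < snd p" "snd p \<le> 1" using C(2)[of p] by auto
        have "f (snd p) \<le> B * snd p ^ DIM('a)" using bound p by simp
        also have "\<dots> \<le> max B 1 * snd p ^ DIM('a)" using p by (intro mult_right_mono) auto
        finally show "ennreal (f (snd p)) \<le> ennreal (max B 1) * ennreal (snd p ^ DIM('a))"
          using B by (simp add: ennreal_mult'[symmetric] ennreal_leI)
      qed
      also have "\<dots> = ennreal (max B 1) * (\<integral>\<^sup>+p. ennreal (snd p ^ DIM('a)) \<partial>count_space C)"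
        by (simp add: nn_integral_cmult)
      also have "\<dots> \<le> ennreal (max B 1) * ennreal (e / max B 1)"
        using C(4) by (intro mult_left_mono) auto
      also have "\<dots> = ennreal e" using B e by (simp add: ennreal_mult''[symmetric])
      finally show ?thesis by simp
    qed
    then have "hausdorff_content f \<rho> (F - E) \<le> 0" by (rule ennreal_le_epsilon)
    then show ?thesis by simp
  qed
  show ?thesis
    unfolding hausdorff_measure_def[of f F]
  proof (rule SUP_least)
    fix \<rho> :: real assume "\<rho> \<in> {0<..}"
    then have \<rho>: "0 < \<rho>" by simp
    have "hausdorff_content f \<rho> F \<le> hausdorff_content f \<rho> (E \<union> (F - E))"
      unfolding hausdorff_content_def by (intro INF_superset_mono) auto
    also have "\<dots> \<le> hausdorff_content f \<rho> E" by (rule hausdorff_content_Un_null[OF null[OF \<rho>]])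
    also have "\<dots> \<le> hausdorff_measure f E" by (rule hausdorff_content_le_measure[OF \<rho>])
    finally show "hausdorff_content f \<rho> F \<le> hausdorff_measure f E" .
  qed
qed

section \<open>Averages of the totient function\<close>

lemma card_multiples_le: "card {n \<in> {1..N}. d dvd n} \<le> N div d" if "0 < (d::nat)"
proof -
  have "{n \<in> {1..N}. d dvd n} \<subseteq> (\<lambda>m. d * m) ` {1..N div d}"
  proof
    fix n assume n: "n \<in> {n \<in> {1..N}. d dvd n}"
    then obtain m where m: "n = d * m" by auto
    with n have "m \<in> {1..N div d}" using that
      by (auto simp: less_eq_div_iff_mult_less_eq mult.commute intro: Suc_leI)
    with m show "n \<in> (\<lambda>m. d * m) ` {1..N div d}" by auto
  qed
  then have "card {n \<in> {1..N}. d dvd n} \<le> card ((\<lambda>m. d * m) ` {1..N div d})"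
    by (intro card_mono) auto
  also have "\<dots> \<le> card {1..N div d}" by (rule card_image_le) auto
  finally show ?thesis by simp
qed

text \<open>
  Summing \<open>n = (\<Sum>d | d dvd n. totient d)\<close> over \<open>n \<le> N\<close> gives
  \<open>N * (N + 1) / 2 \<le> (\<Sum>d\<le>N. (N / d) * totient d)\<close>.
\<close>

lemma sum_totient_ratio_ge: "real N / 2 \<le> (\<Sum>n=1..N. real (totient n) / real n)"
proof (cases "N = 0")
  case False
  have "(\<Sum>n=1..N. n) = (\<Sum>n=1..N. \<Sum>d | d dvd n. totient d)"
    by (simp add: totient_divisor_sum)
  also have "\<dots> = (\<Sum>n=1..N. \<Sum>d\<in>{d\<in>{1..N}. d dvd n}. totient d)"
  proof (intro sum.cong refl)
    fix n assume n: "n \<in> {1..N}"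
    then have "d \<in> {1..N}" if "d dvd n" for d
      using that dvd_imp_le[of d n] by (auto intro: Suc_leI dvd_pos_nat)
    then show "{d. d dvd n} = {d\<in>{1..N}. d dvd n}" by auto
  qed
  also have "\<dots> = (\<Sum>d=1..N. \<Sum>n\<in>{n\<in>{1..N}. d dvd n}. totient d)"
    by (rule sum.swap_restrict) auto
  also have "\<dots> = (\<Sum>d=1..N. card {n\<in>{1..N}. d dvd n} * totient d)" by simp
  also have "\<dots> \<le> (\<Sum>d=1..N. (N div d) * totient d)"
    by (intro sum_mono mult_right_mono card_multiples_le) auto
  finally have "real (\<Sum>n=1..N. n) \<le> real (\<Sum>d=1..N. (N div d) * totient d)" by (rule of_nat_mono)
  also have "\<dots> = (\<Sum>d=1..N. real (N div d) * real (totient d))" by simp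
  also have "\<dots> \<le> (\<Sum>d=1..N. real N / real d * real (totient d))"
    by (intro sum_mono mult_right_mono of_nat_div_le_of_nat) auto
  also have "\<dots> = real N * (\<Sum>n=1..N. real (totient n) / real n)"
    by (simp add: sum_distrib_left)
  finally have le: "real (\<Sum>n=1..N. n) \<le> real N * (\<Sum>n=1..N. real (totient n) / real n)" .
  have "real (\<Sum>n=1..N. n) = real N * (real N + 1) / 2"
    using double_gauss_sum_from_Suc_0[of N, where 'a = real] by simp
  with le have "real N * ((real N + 1) / 2) \<le> real N * (\<Sum>n=1..N. real (totient n) / real n)"
    by (simp only: times_divide_eq_right)
  with False have "(real N + 1) / 2 \<le> (\<Sum>n=1..N. real (totient n) / real n)"
    by (simp only: mult_le_cancel_left_pos of_nat_0_less_iff neq0_conv)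
  then show ?thesis by simp
qed simp

text \<open>
  On the block \<open>{4^j<..4^Suc j}\<close> the ratios \<open>totient n / n\<close> have mean at least \<open>1 / 3\<close>, because those
  with \<open>n \<le> 4^j\<close> contribute at most \<open>4^j\<close> to the sum up to \<open>4^Suc j\<close>. Bernoulli's inequality passes
  to the mean of the powers.
\<close>

lemma sum_totient_ratio_power_ge:
  "4 ^ j / 3 ^ k \<le> (\<Sum>n\<in>{4^j<..4^Suc j}. (real (totient n) / real n) ^ k)"
proof -
  let ?B = "{4^j<..4^Suc j} :: nat set"
  let ?x = "\<lambda>n. real (totient n) / real n"
  have split: "{1..4^Suc j} = {1..4^j} \<union> ?B" "{1..4^j} \<inter> ?B = {}" by auto
  have "real (4 ^ Suc j) / 2 \<le> (\<Sum>n=1..4^Suc j. ?x n)" by (rule sum_totient_ratio_ge)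
  also have "\<dots> = (\<Sum>n=1..4^j. ?x n) + (\<Sum>n\<in>?B. ?x n)"
    unfolding split(1) by (rule sum.union_disjoint) (use split(2) in auto)
  also have "(\<Sum>n=1..4^j. ?x n) \<le> (\<Sum>n=1..(4::nat)^j. 1)"
    by (intro sum_mono) (auto simp: divide_le_eq totient_le)
  finally have mean: "4 ^ j \<le> (\<Sum>n\<in>?B. ?x n)" by simp
  have card: "real (card ?B) = 3 * 4 ^ j" by simp
  \<comment> \<open>The factor \<open>3\<close> normalizes the lower bound \<open>1 / 3\<close> of the mean to \<open>1\<close>, so that the linear term of Bernoulli's inequality is nonnegative.\<close>
  have "3 * 4 ^ j + real k * (3 * 4 ^ j - 3 * 4 ^ j) \<le> 3 * 4 ^ j + real k * (3 * (\<Sum>n\<in>?B. ?x n) - 3 * 4 ^ j)"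
    using mean by (intro add_left_mono mult_left_mono) auto
  also have "\<dots> = (\<Sum>n\<in>?B. 1 + real k * (3 * ?x n - 1))"
    using card by (simp only: sum.distrib sum_subtractf sum_distrib_left[symmetric] sum_constant) simp
  also have "\<dots> \<le> (\<Sum>n\<in>?B. (1 + (3 * ?x n - 1)) ^ k)"
    by (intro sum_mono Bernoulli_inequality) simp
  also have "\<dots> = 3 ^ k * (\<Sum>n\<in>?B. ?x n ^ k)"
    by (simp add: power_mult_distrib power_divide sum_distrib_left)
  finally have "3 * 4 ^ j \<le> 3 ^ k * (\<Sum>n\<in>?B. ?x n ^ k)" by simp
  moreover have "(4::real) ^ j \<le> 3 * 4 ^ j" by simp
  ultimately have "4 ^ j \<le> 3 ^ k * (\<Sum>n\<in>?B. ?x n ^ k)" by linarith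
  then show ?thesis by (simp add: divide_le_eq mult.commute)
qed

section \<open>The Abel-Dini scale\<close>

lemma abel_dini_divergent:
  fixes b :: "nat \<Rightarrow> real"
  assumes b: "\<And>i. 0 \<le> b i \<and> b i \<le> 1" and div: "\<not> summable b"
  shows "\<not> summable (\<lambda>i. b i / (1 + sum b {..i}))"
proof
  define S where "S i = 1 + sum b {..<i}" for i
  have S: "1 \<le> S i" for i unfolding S_def using b by (simp add: sum_nonneg)
  have S_Suc: "S (Suc i) = S i + b i" for i by (simp add: S_def)
  assume "summable (\<lambda>i. b i / (1 + sum b {..i}))"
  then have sm: "summable (\<lambda>i. b i / S (Suc i))" by (simp add: S_def lessThan_Suc_atMost)
  have step: "ln (S (Suc i)) - ln (S i) \<le> 2 * (b i / S (Suc i))" for i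
  proof -
    have pos: "0 < S i" "0 < S (Suc i)" using S[of i] S[of "Suc i"] by linarith+
    then have "ln (S (Suc i)) - ln (S i) = ln (S (Suc i) / S i)" by (simp add: ln_div)
    also have "S (Suc i) / S i = 1 + b i / S i" using pos by (simp add: S_Suc add_divide_distrib)
    also have "ln (1 + b i / S i) \<le> b i / S i" using b[of i] S[of i] by (intro ln_add_one_self_le_self) auto
    also have "\<dots> \<le> 2 * (b i / S (Suc i))"
    proof -
      have "S (Suc i) \<le> 2 * S i" using b[of i] S[of i] by (simp add: S_Suc)
      then have "b i * S (Suc i) \<le> b i * (2 * S i)" using b[of i] by (intro mult_left_mono) auto
      then show ?thesis using S[of i] S[of "Suc i"] by (simp add: field_simps)
    qed
    finally show ?thesis .
  qed
  define L where "L = 2 * (\<Sum>i. b i / S (Suc i))"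
  have "ln (S n) \<le> L" for n
  proof -
    have "ln (S n) = (\<Sum>i<n. ln (S (Suc i)) - ln (S i))"
      by (subst sum_lessThan_telescope) (simp add: S_def)
    also have "\<dots> \<le> (\<Sum>i<n. 2 * (b i / S (Suc i)))" by (intro sum_mono step)
    also have "\<dots> = 2 * (\<Sum>i<n. b i / S (Suc i))" by (simp add: sum_distrib_left)
    also have "\<dots> \<le> L" unfolding L_def
      using sm b S by (intro mult_left_mono sum_le_suminf) (auto intro!: divide_nonneg_nonneg intro: order_trans[OF zero_le_one])
    finally show ?thesis .
  qed
  then have bd: "S n \<le> exp L" for n using S[of n] by (metis exp_le_cancel_iff exp_ln less_le_trans zero_less_one)
  have "summable b"
  proof (rule bounded_imp_summable)
    show "0 \<le> b n" for n using b by simp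
    show "sum b {..n} \<le> exp L" for n using bd[of "Suc n"] by (simp add: S_def lessThan_Suc_atMost)
  qed
  with div show False by simp
qed

lemma abel_dini_convergent:
  fixes b :: "nat \<Rightarrow> real"
  assumes b: "\<And>i. 0 \<le> b i" and a: "0 < a"
  shows "summable (\<lambda>i. b i / (1 + sum b {..i}) powr (1 + a))"
proof -
  define S where "S i = 1 + sum b {..<i}" for i
  have S: "1 \<le> S i" for i unfolding S_def using b by (simp add: sum_nonneg)
  have S_Suc: "S (Suc i) = S i + b i" for i by (simp add: S_def)
  have step: "b i / S (Suc i) powr (1 + a) \<le> (S i powr - a - S (Suc i) powr - a) / a" for i
  proof -
    have pos: "0 < S i" "0 < S (Suc i)" using S[of i] S[of "Suc i"] by linarith+
    define y where "y = S (Suc i) / S i"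
    have y: "0 < y" using pos by (simp add: y_def)
    have "1 - 1 / y \<le> ln y"
      using ln_le_minus_one[of "1 / y"] y by (simp add: ln_div)
    then have "a * (1 - 1 / y) \<le> a * ln y" using a by (intro mult_left_mono) auto
    also have "\<dots> \<le> exp (a * ln y) - 1" using exp_ge_add_one_self[of "a * ln y"] by linarith
    also have "exp (a * ln y) = y powr a" using y by (simp add: powr_def)
    finally have "a * (1 - 1 / y) \<le> y powr a - 1" .
    then have "a * (1 - 1 / y) * S (Suc i) powr - a \<le> (y powr a - 1) * S (Suc i) powr - a"
      by (intro mult_right_mono) auto
    moreover have "(y powr a - 1) * S (Suc i) powr - a = S i powr - a - S (Suc i) powr - a"
      using pos by (simp add: y_def powr_divide powr_minus field_simps)
    moreover have "a * (1 - 1 / y) * S (Suc i) powr - a = a * (b i / S (Suc i) powr (1 + a))"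
      using pos by (simp add: y_def S_Suc powr_add powr_minus field_simps)
    ultimately show ?thesis using a by (simp add: field_simps)
  qed
  have "summable (\<lambda>i. b i / S (Suc i) powr (1 + a))"
  proof (rule bounded_imp_summable)
    show "0 \<le> b n / S (Suc n) powr (1 + a)" for n using b by simp
    show "(\<Sum>i\<le>n. b i / S (Suc i) powr (1 + a)) \<le> 1 / a" for n
    proof -
      have "(\<Sum>i\<le>n. b i / S (Suc i) powr (1 + a)) \<le> (\<Sum>i\<le>n. (S i powr - a - S (Suc i) powr - a) / a)"
        by (intro sum_mono step)
      also have "\<dots> = (S 0 powr - a - S (Suc n) powr - a) / a"
        using sum_lessThan_telescope'[of "\<lambda>i. S i powr - a" "Suc n"]
        by (simp only: lessThan_Suc_atMost sum_divide_distrib[symmetric])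
      also have "\<dots> \<le> 1 / a" using a by (intro divide_right_mono) (auto simp: S_def)
      finally show ?thesis .
    qed
  qed
  then show ?thesis by (simp add: S_def lessThan_Suc_atMost)
qed

lemma tail_maximum_exists:
  fixes T :: "nat \<Rightarrow> real"
  assumes pos: "\<And>i. 0 < T i" and lim: "T \<longlonglongrightarrow> 0"
  shows "\<exists>m\<ge>j. \<forall>l\<ge>j. T l \<le> T m"
proof -
  obtain N where N: "\<And>l. N \<le> l \<Longrightarrow> T l < T j"
    using order_tendstoD(2)[OF lim pos[of j]] by (auto simp: eventually_sequentially)
  let ?F = "T ` {j..max j N}"
  have F: "finite ?F" "?F \<noteq> {}" by auto
  then obtain m where m: "m \<in> {j..max j N}" "T m = Max ?F" using Max_in by (metis imageE)
  have "T l \<le> T m" if "j \<le> l" for l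
  proof (cases "l \<le> max j N")
    case True
    then show ?thesis using that m(2) F by auto
  next
    case False
    then have "T l < T j" using N[of l] by simp
    also have "T j \<le> T m" using m(2) F by auto
    finally show ?thesis by simp
  qed
  with m(1) show ?thesis by auto
qed

text \<open>
  The map \<open>m\<close> need not be injective: an index \<open>i\<close> may be hit by many \<open>j \<le> i\<close>, and these occur with
  the weights \<open>(1/2) ^ (i - j)\<close>.
\<close>

lemma shifted_geometric_summable:
  fixes h :: "nat \<Rightarrow> real" and m :: "nat \<Rightarrow> nat"
  assumes h: "\<And>i. 0 \<le> h i" "summable h" and m: "\<And>j. j \<le> m j"
  shows "summable (\<lambda>j. (1/2) ^ (m j - j) * h (m j))"
proof (rule bounded_imp_summable)
  show "0 \<le> (1/2) ^ (m n - n) * h (m n)" for n using h by simp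
  show "(\<Sum>j\<le>n. (1/2) ^ (m j - j) * h (m j)) \<le> 2 * suminf h" for n
  proof -
    define L where "L = Max (m ` {..n})"
    have "(\<Sum>j\<le>n. (1/2) ^ (m j - j) * h (m j)) \<le> (\<Sum>j\<le>n. \<Sum>d\<le>L. (1/2) ^ d * h (j + d))"
    proof (rule sum_mono)
      fix j assume j: "j \<in> {..n}"
      have "m j \<le> L" using j by (auto simp: L_def)
      then have "(1/2) ^ (m j - j) * h (j + (m j - j)) \<le> (\<Sum>d\<le>L. (1/2) ^ d * h (j + d))"
        using h by (intro member_le_sum[of "m j - j" _ "\<lambda>d. (1/2) ^ d * h (j + d)"]) auto
      then show "(1/2) ^ (m j - j) * h (m j) \<le> (\<Sum>d\<le>L. (1/2) ^ d * h (j + d))" using m[of j] by simp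
    qed
    also have "\<dots> = (\<Sum>d\<le>L. (1/2) ^ d * (\<Sum>j\<le>n. h (j + d)))"
      by (subst sum.swap) (simp add: sum_distrib_left)
    also have "\<dots> \<le> (\<Sum>d\<le>L. (1/2) ^ d * suminf h)"
    proof (intro sum_mono mult_left_mono)
      fix d
      have "(\<Sum>j\<le>n. h (j + d)) = sum h ((\<lambda>j. j + d) ` {..n})"
        by (subst sum.reindex) auto
      also have "\<dots> \<le> suminf h" using h by (intro sum_le_suminf) auto
      finally show "(\<Sum>j\<le>n. h (j + d)) \<le> suminf h" .
    qed simp
    also have "\<dots> = (\<Sum>d\<le>L. (1/2) ^ d) * suminf h" by (simp add: sum_distrib_right)
    also have "\<dots> \<le> 2 * suminf h"
    proof (rule mult_right_mono)
      have "(\<Sum>d\<le>L. (1/2::real) ^ d) \<le> (\<Sum>d. (1/2) ^ d)" by (intro sum_le_suminf) auto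
      then show "(\<Sum>d\<le>L. (1/2::real) ^ d) \<le> 2" by (simp add: suminf_geometric)
      show "0 \<le> suminf h" using h by (intro suminf_nonneg) auto
    qed
    finally show ?thesis .
  qed
qed

section \<open>Monotonic step functions on blocks\<close>

text \<open>
  Here \<open>g\<close> is nonincreasing but \<open>n * g n\<close> need not be monotonic. The numbers \<open>M j\<close> are the \<open>k\<close>-th
  powers of a nonincreasing step function, constant on the blocks \<open>{4^j<..4^Suc j}\<close>, which
  still has a divergent series and which is at most \<open>n * g n\<close> on all blocks with index in \<open>G\<close>. The series over the
  other blocks converges.

  Truncate the terms \<open>A i\<close> of the condensed series to \<open>b i = min (A i) 1\<close>, divide them by the partial sums \<open>S i\<close>, and let
  \<open>T i = b i / (4 ^ i * S i)\<close>, so that \<open>4 ^ i * T i\<close> still has a divergent series by Abel-Dini. Then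
  \<open>M j\<close> is the maximum of \<open>T\<close> on \<open>{j..}\<close>, attained at \<open>m j\<close>. If \<open>m j\<close> is close to \<open>j\<close>, in the sense that
  \<open>4 ^ ((m j - j) * k) \<le> S (m j)\<close>, the division by \<open>S (m j)\<close> makes up for the difference between the blocks \<open>j\<close> and
  \<open>m j\<close>. Otherwise \<open>4 ^ j * M j\<close> is less than \<open>4 ^ m j * T (m j)\<close> by a factor \<open>4 ^ (m j - j)\<close>, one square
  root of which exceeds a power of \<open>S (m j)\<close> and makes the Abel-Dini series
  converge, whereas the other one compensates for the multiplicities of \<open>m\<close>.
\<close>

lemma monotone_step_function:
  fixes g :: "nat \<Rightarrow> real"
  assumes gpos: "\<And>n. 0 < n \<Longrightarrow> 0 < g n" and ganti: "\<And>m n. 0 < m \<Longrightarrow> m \<le> n \<Longrightarrow> g n \<le> g m"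
    and k: "0 < k"
    and div: "\<not> summable (\<lambda>i. 4 ^ (i * Suc k) * g (4 ^ Suc i) ^ k)"
  obtains M :: "nat \<Rightarrow> real" and G :: "nat set"
  where "\<And>j. 0 < M j" "\<And>j. M j \<le> 1" "\<And>i j. i \<le> j \<Longrightarrow> M j \<le> M i"
    "\<not> summable (\<lambda>j. 4 ^ j * M j)"
    "summable (\<lambda>j. if j \<in> G then 0 else 4 ^ j * M j)"
    "\<And>j n. j \<in> G \<Longrightarrow> 4 ^ j < n \<Longrightarrow> n \<le> 4 ^ Suc j \<Longrightarrow> M j \<le> (real n * g n) ^ k"
proof -
  define A where "A i = 4 ^ (i * Suc k) * g (4 ^ Suc i) ^ k" for i
  define b where "b i = min (A i) 1" for i
  define S where "S i = 1 + sum b {..i}" for i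
  define T where "T i = b i / (4 ^ i * S i)" for i
  have A: "0 < A i" for i using gpos by (simp add: A_def)
  have b: "0 < b i" "b i \<le> 1" "b i \<le> A i" for i using A by (auto simp: b_def)
  have S: "1 \<le> S i" for i unfolding S_def using b(1) by (simp add: sum_nonneg less_imp_le)
  have S0: "0 < S i" for i using S[of i] by linarith
  have T: "0 < T i" for i using b S0 by (simp add: T_def)
  have T_le: "T i \<le> (1/4) ^ i" for i
  proof -
    have "b i / (4 ^ i * S i) \<le> 1 / (4 ^ i * 1)" using b(2)[of i] b(1)[of i] S[of i] by (intro frac_le) auto
    then show ?thesis by (simp add: T_def power_divide)
  qed
  have b_div: "\<not> summable b"
  proof
    assume sb: "summable b"
    then have "b \<longlonglongrightarrow> 0" by (rule summable_LIMSEQ_zero)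
    then have "eventually (\<lambda>i. b i < 1) sequentially" by (rule order_tendstoD) simp
    then have "eventually (\<lambda>i. norm (A i) \<le> b i) sequentially"
    proof eventually_elim
      case (elim i) then show ?case using A[of i] by (auto simp: b_def min_def split: if_splits)
    qed
    then have "summable A" using sb by (rule summable_comparison_test_ev)
    then show False using div by (simp add: A_def[abs_def])
  qed
  have "T \<longlonglongrightarrow> 0"
  proof (rule tendsto_sandwich)
    show "eventually (\<lambda>n. 0 \<le> T n) sequentially" using T by (simp add: less_imp_le)
    show "eventually (\<lambda>n. T n \<le> (1/4) ^ n) sequentially" using T_le by simp
    show "(\<lambda>n. (1/4::real) ^ n) \<longlonglongrightarrow> 0" by (intro LIMSEQ_power_zero) auto
  qed auto
  then have "\<forall>j. \<exists>m\<ge>j. \<forall>l\<ge>j. T l \<le> T m" using tail_maximum_exists T by blast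
  then obtain m where m: "\<And>j. j \<le> m j" "\<And>j l. j \<le> l \<Longrightarrow> T l \<le> T (m j)" by metis
  \<comment> \<open>The exponent for which \<open>S < 4 ^ (d * k)\<close> means \<open>S powr a < 2 ^ d\<close>.\<close>
  define a where "a = 1 / (2 * real k)"
  have a: "0 < a" using k by (simp add: a_def)
  define h where "h i = b i / S i powr (1 + a)" for i
  have h: "0 \<le> h i" for i using b(1)[of i] by (simp add: h_def)
  have "summable h" unfolding h_def[abs_def] S_def[abs_def]
    using b(1) a by (intro abel_dini_convergent) (auto intro: less_imp_le)
  then have v: "summable (\<lambda>j. (1/2) ^ (m j - j) * h (m j))"
    using h m(1) by (intro shifted_geometric_summable)
  define G where "G = {j. 4 ^ ((m j - j) * k) \<le> S (m j)}"
  show thesis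
  proof (rule that[of "\<lambda>j. T (m j)" G])
    show "0 < T (m j)" for j by (rule T)
    show "T (m j) \<le> 1" for j using T_le[of "m j"] by (rule order_trans) (simp add: power_le_one)
    show "T (m j) \<le> T (m i)" if "i \<le> j" for i j using that m(1)[of j] by (intro m(2)) simp
    show "\<not> summable (\<lambda>j. 4 ^ j * T (m j))"
    proof
      assume "summable (\<lambda>j. 4 ^ j * T (m j))"
      moreover have "norm (b j / S j) \<le> 4 ^ j * T (m j)" for j
      proof -
        have "b j / S j = 4 ^ j * T j" by (simp add: T_def)
        also have "\<dots> \<le> 4 ^ j * T (m j)" by (intro mult_left_mono m(2)) auto
        finally show ?thesis using b(1)[of j] S0[of j] by simp
      qed
      ultimately have "summable (\<lambda>j. b j / S j)" by (rule summable_comparison_test')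
      moreover have "\<not> summable (\<lambda>j. b j / S j)"
        unfolding S_def[abs_def] using b b_div by (intro abel_dini_divergent) (auto intro: less_imp_le)
      ultimately show False by simp
    qed
    have bad: "4 ^ j * T (m j) \<le> (1/2) ^ (m j - j) * h (m j)" if j: "j \<notin> G" for j
    proof -
      define d where "d = m j - j"
      have mj: "m j = j + d" using m(1)[of j] by (simp add: d_def)
      have "S (m j) < 4 ^ (d * k)" using j by (simp add: G_def d_def)
      then have "S (m j) powr a < (4 ^ (d * k)) powr a" using a S0 by (intro powr_less_mono2) (auto intro: less_imp_le)
      also have "(4 ^ (d * k) :: real) = 2 powr (real (2 * (d * k)))"
        by (subst powr_realpow) (auto simp: power_mult)
      also have "\<dots> powr a = 2 powr real d" using k by (simp add: powr_powr a_def)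
      finally have "S (m j) powr a < 2 ^ d" by (simp add: powr_realpow)
      then have le: "(1/2) ^ d \<le> 1 / S (m j) powr a"
        using S0[of "m j"] by (simp add: power_divide field_simps)
      have "4 ^ j * T (m j) = (1/4) ^ d * (b (m j) / S (m j))"
        by (simp add: T_def mj power_add power_divide)
      also have "(1/4::real) ^ d = (1/2) ^ d * (1/2) ^ d" by (simp flip: power_mult_distrib)
      also have "\<dots> * (b (m j) / S (m j)) \<le> (1/2) ^ d * (1 / S (m j) powr a) * (b (m j) / S (m j))"
        using le b(1)[of "m j"] S0[of "m j"] by (intro mult_right_mono mult_left_mono) auto
      also have "\<dots> = (1/2) ^ d * h (m j)" using S0[of "m j"] by (simp add: h_def powr_add)
      finally show ?thesis by (simp add: d_def)
    qed
    show "summable (\<lambda>j. if j \<in> G then 0 else 4 ^ j * T (m j))"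
      by (rule summable_comparison_test'[OF v]) (use bad h T in \<open>auto simp: less_imp_le\<close>)
    show "T (m j) \<le> (real n * g n) ^ k" if j: "j \<in> G" and n: "4 ^ j < n" "n \<le> 4 ^ Suc j" for j n
    proof -
      define d where "d = m j - j"
      have mj: "m j = j + d" using m(1)[of j] by (simp add: d_def)
      have "T (m j) \<le> A (m j) / (4 ^ m j * S (m j))"
        unfolding T_def using b(3) S0 by (intro divide_right_mono) (auto simp: less_imp_le)
      also have "\<dots> \<le> A (m j) / (4 ^ m j * 4 ^ (d * k))"
        using j A S0 by (intro divide_left_mono mult_left_mono) (auto simp: G_def d_def less_imp_le)
      also have "\<dots> = (4 ^ j) ^ k * g (4 ^ Suc (m j)) ^ k"
        by (simp add: A_def mj power_add power_mult[symmetric] algebra_simps)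
      also have "\<dots> \<le> (real n) ^ k * g n ^ k"
      proof (intro mult_mono power_mono)
        have "n \<le> 4 ^ Suc (m j)" using n(2) m(1)[of j] by (meson le_trans Suc_le_mono one_le_numeral power_increasing)
        then show "g (4 ^ Suc (m j)) \<le> g n" using n(1) by (intro ganti) auto
        show "(4::real) ^ j \<le> real n" using n(1) by (metis less_imp_le of_nat_le_iff of_nat_numeral of_nat_power)
        show "0 \<le> g (4 ^ Suc (m j))" by (simp add: gpos less_imp_le)
        show "0 \<le> g (4 ^ Suc (m j)) ^ k" by (simp add: gpos less_imp_le)
      qed auto
      finally show ?thesis by (simp add: power_mult_distrib)
    qed
  qed
qed

text \<open>
  Cauchy condensation along the powers of \<open>4\<close>. Here \<open>g\<close> is evaluated at the right end
  \<open>4 ^ Suc i\<close> of the block with index \<open>i\<close>, where it bounds \<open>g\<close> on the whole block from below.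
\<close>

lemma not_summable_condensation:
  fixes g :: "nat \<Rightarrow> real"
  assumes gpos: "\<And>n. 0 < n \<Longrightarrow> 0 < g n" and ganti: "\<And>m n. 0 < m \<Longrightarrow> m \<le> n \<Longrightarrow> g n \<le> g m"
    and div: "\<not> summable (\<lambda>n. (real (totient (Suc n)) * g (Suc n)) ^ k)"
  shows "\<not> summable (\<lambda>i. 4 ^ (i * Suc k) * g (4 ^ Suc i) ^ k)"
proof
  define A where "A i = 4 ^ (i * Suc k) * g (4 ^ Suc i) ^ k" for i
  define a where "a n = (real (totient n) * g n) ^ k" for n
  define C :: real where "C = 4 ^ (2 * Suc k)"
  assume "summable (\<lambda>i. 4 ^ (i * Suc k) * g (4 ^ Suc i) ^ k)"
  then have A: "summable A" by (simp add: A_def[abs_def])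
  have A0: "0 \<le> A i" for i using gpos[of "4 ^ Suc i"] by (simp add: A_def less_imp_le)
  have a0: "0 \<le> a n" for n using gpos[of n] by (cases "n = 0") (auto simp: a_def less_imp_le)
  have block: "(\<Sum>n\<in>{4 ^ Suc i<..4 ^ Suc (Suc i)}. a n) \<le> C * A i" for i
  proof -
    have "(\<Sum>n\<in>{4 ^ Suc i<..4 ^ Suc (Suc i)}. a n)
        \<le> (\<Sum>n\<in>{4 ^ Suc i<..(4::nat) ^ Suc (Suc i)}. (4 ^ Suc (Suc i) * g (4 ^ Suc i)) ^ k)"
    proof (rule sum_mono)
      fix n :: nat assume n: "n \<in> {4 ^ Suc i<..4 ^ Suc (Suc i)}"
      then have n0: "0 < n" by auto
      have "real (totient n) \<le> real (4 ^ Suc (Suc i))"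
        using n totient_le[of n] by (intro of_nat_mono) auto
      moreover have "g n \<le> g (4 ^ Suc i)" using n by (intro ganti) auto
      ultimately show "a n \<le> (4 ^ Suc (Suc i) * g (4 ^ Suc i)) ^ k"
        unfolding a_def using gpos[OF n0] by (intro power_mono mult_mono) (auto simp: less_imp_le)
    qed
    also have "\<dots> = real (card {4 ^ Suc i<..(4::nat) ^ Suc (Suc i)}) * (4 ^ Suc (Suc i) * g (4 ^ Suc i)) ^ k"
      by simp
    also have "\<dots> \<le> 4 ^ Suc (Suc i) * (4 ^ Suc (Suc i) * g (4 ^ Suc i)) ^ k"
    proof (rule mult_right_mono)
      have "real (card {4 ^ Suc i<..(4::nat) ^ Suc (Suc i)}) \<le> real (4 ^ Suc (Suc i))"
        by (intro of_nat_mono) auto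
      then show "real (card {4 ^ Suc i<..(4::nat) ^ Suc (Suc i)}) \<le> 4 ^ Suc (Suc i)" by simp
      show "0 \<le> (4 ^ Suc (Suc i) * g (4 ^ Suc i)) ^ k"
        using gpos[of "4 ^ Suc i"] by (simp add: less_imp_le)
    qed
    also have "\<dots> = C * A i"
    proof -
      have "(4::real) ^ Suc (Suc i) * (4 ^ Suc (Suc i)) ^ k = 4 ^ (Suc (Suc i) * Suc k)"
        by (simp only: power_mult power_Suc)
      also have "Suc (Suc i) * Suc k = 2 * Suc k + i * Suc k" by simp
      finally have e: "(4::real) ^ Suc (Suc i) * (4 ^ Suc (Suc i)) ^ k = C * 4 ^ (i * Suc k)"
        by (simp only: C_def power_add)
      have "4 ^ Suc (Suc i) * (4 ^ Suc (Suc i) * g (4 ^ Suc i)) ^ k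
          = (4 ^ Suc (Suc i) * (4 ^ Suc (Suc i)) ^ k) * g (4 ^ Suc i) ^ k"
        by (simp only: power_mult_distrib mult.assoc)
      then show ?thesis unfolding e A_def by (simp only: mult.assoc)
    qed
    finally show ?thesis .
  qed
  have bound: "(\<Sum>n=1..4 ^ Suc J. a n) \<le> (\<Sum>n=1..4. a n) + C * (\<Sum>i<J. A i)" for J
  proof (induction J)
    case (Suc J)
    have split: "{1..4 ^ Suc (Suc J)} = {1..4 ^ Suc J} \<union> {4 ^ Suc J<..(4::nat) ^ Suc (Suc J)}"
      by auto
    have "(\<Sum>n=1..4 ^ Suc (Suc J). a n)
        = (\<Sum>n=1..4 ^ Suc J. a n) + (\<Sum>n\<in>{4 ^ Suc J<..4 ^ Suc (Suc J)}. a n)"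
      unfolding split by (rule sum.union_disjoint) auto
    with Suc block[of J] show ?case by (simp add: distrib_left)
  qed simp
  have "summable (\<lambda>n. a (Suc n))"
  proof (rule bounded_imp_summable)
    show "0 \<le> a (Suc n)" for n by (rule a0)
    show "(\<Sum>j\<le>n. a (Suc j)) \<le> (\<Sum>n=1..4. a n) + C * suminf A" for n
    proof -
      have "n < 4 ^ Suc n" by (rule less_trans[OF lessI, of n "4 ^ Suc n", OF power_gt_expt]) simp
      have "(\<Sum>j\<le>n. a (Suc j)) \<le> (\<Sum>j<4 ^ Suc n. a (Suc j))"
        using a0 \<open>n < 4 ^ Suc n\<close> by (intro sum_mono2) auto
      also have "\<dots> = (\<Sum>n=1..4 ^ Suc n. a n)" by (simp only: One_nat_def sum.atLeast1_atMost_eq)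
      also have "\<dots> \<le> (\<Sum>n=1..4. a n) + C * (\<Sum>i<n. A i)" by (rule bound)
      also have "\<dots> \<le> (\<Sum>n=1..4. a n) + C * suminf A"
        using A A0 by (intro add_left_mono mult_left_mono sum_le_suminf) (auto simp: C_def)
      finally show ?thesis .
    qed
  qed
  with div show False by (simp add: a_def)
qed

text \<open>
  The index \<open>j\<close> of the block \<open>{4^j<..4^Suc j}\<close> that contains \<open>x\<close>; all \<open>x \<le> 4\<close> have level \<open>0\<close>.
\<close>

definition level :: "real \<Rightarrow> nat" where
  "level x = (LEAST j. x \<le> 4 ^ Suc j)"

lemma level_upper: "x \<le> 4 ^ Suc (level x)"
proof -
  obtain n where "x < 4 ^ n" using real_arch_pow[of 4 x] by auto
  also have "(4::real) ^ n \<le> 4 ^ Suc n" by simp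
  finally have "x \<le> 4 ^ Suc n" by simp
  then show ?thesis unfolding level_def by (rule LeastI)
qed

lemma level_mono: "x \<le> y \<Longrightarrow> level x \<le> level y"
  unfolding level_def[of x] using level_upper[of y] by (intro Least_le) simp

lemma level_lower:
  assumes "1 < x" shows "4 ^ level x < x"
proof (cases "level x")
  case (Suc j)
  have "\<not> x \<le> 4 ^ Suc j" using not_less_Least[of j "\<lambda>j. x \<le> 4 ^ Suc j"] Suc by (simp add: level_def)
  then show ?thesis using Suc by simp
qed (use assms in simp)

lemma level_eq:
  assumes "4 ^ j < x" "x \<le> 4 ^ Suc j" shows "level x = j"
  unfolding level_def
proof (rule Least_equality)
  show "j \<le> i" if "x \<le> 4 ^ Suc i" for i
  proof -
    have "(4::real) ^ j < 4 ^ Suc i" using assms(1) that by linarith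
    then show ?thesis by (simp add: power_strict_increasing_iff del: power_Suc)
  qed
qed (rule assms(2))

lemma not_summable_level:
  fixes M :: "nat \<Rightarrow> real"
  assumes M: "\<And>j. 0 < M j" and div: "\<not> summable (\<lambda>j. 4 ^ j * M j)"
  shows "\<not> summable (\<lambda>n. (real (totient (Suc n)) / real (Suc n)) ^ k * M (level (real (Suc n))))"
proof
  define w where "w n = (real (totient n) / real n) ^ k * M (level (real n))" for n
  have w0: "0 \<le> w n" for n using M by (simp add: w_def less_imp_le)
  assume "summable (\<lambda>n. (real (totient (Suc n)) / real (Suc n)) ^ k * M (level (real (Suc n))))"
  then have w: "summable (\<lambda>n. w (Suc n))" by (simp add: w_def)
  have block: "4 ^ j * M j \<le> 3 ^ k * (\<Sum>n\<in>{4 ^ j<..4 ^ Suc j}. w n)" for j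
  proof -
    have "4 ^ j / 3 ^ k * M j \<le> (\<Sum>n\<in>{4^j<..4^Suc j}. (real (totient n) / real n) ^ k) * M j"
      using M by (intro mult_right_mono sum_totient_ratio_power_ge) (auto simp: less_imp_le)
    also have "\<dots> = (\<Sum>n\<in>{4^j<..4^Suc j}. w n)"
      unfolding sum_distrib_right
    proof (rule sum.cong)
      fix n :: nat assume n: "n \<in> {4 ^ j<..4 ^ Suc j}"
      then have "real (4 ^ j) < real n" "real n \<le> real (4 ^ Suc j)" unfolding of_nat_less_iff of_nat_le_iff by auto
      then have "level (real n) = j" by (intro level_eq) auto
      then show "(real (totient n) / real n) ^ k * M j = w n" by (simp add: w_def)
    qed simp
    finally show ?thesis by (simp add: field_simps)
  qed
  have bound: "(\<Sum>j<J. 4 ^ j * M j) \<le> 3 ^ k * (\<Sum>n=1..4 ^ J. w n)" for J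
  proof (induction J)
    case 0
    show ?case using w0 by simp
  next
    case (Suc J)
    have split: "{1..4 ^ Suc J} = {1..4 ^ J} \<union> {4 ^ J<..(4::nat) ^ Suc J}" by auto
    have "(\<Sum>n=1..4 ^ Suc J. w n) = (\<Sum>n=1..4 ^ J. w n) + (\<Sum>n\<in>{4 ^ J<..4 ^ Suc J}. w n)"
      unfolding split by (rule sum.union_disjoint) auto
    with Suc block[of J] show ?case by (simp add: distrib_left)
  qed
  have "summable (\<lambda>j. 4 ^ j * M j)"
  proof (rule bounded_imp_summable)
    show "0 \<le> 4 ^ n * M n" for n using M by (simp add: less_imp_le)
    show "(\<Sum>j\<le>n. 4 ^ j * M j) \<le> 3 ^ k * (\<Sum>n. w (Suc n))" for n
    proof -
      have "(\<Sum>j\<le>n. 4 ^ j * M j) \<le> 3 ^ k * (\<Sum>n=1..4 ^ Suc n. w n)"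
        using bound[of "Suc n"] by (simp only: lessThan_Suc_atMost)
      also have "(\<Sum>n=1..4 ^ Suc n. w n) = (\<Sum>j<4 ^ Suc n. w (Suc j))"
        by (simp only: One_nat_def sum.atLeast1_atMost_eq)
      also have "3 ^ k * \<dots> \<le> 3 ^ k * (\<Sum>n. w (Suc n))"
        using w w0 by (intro mult_left_mono sum_le_suminf) auto
      finally show ?thesis .
    qed
  qed
  with div show False ..
qed

section \<open>Simultaneously approximable points\<close>

text \<open>
  Each denominator \<open>q\<close> admits only finitely many numerators \<open>p\<close>, so that infinitely many pairs
  amount to arbitrarily large denominators.
\<close>

lemma simul_approx_set_iff:
  "y \<in> simul_approx_set \<psi> \<longleftrightarrow> y \<in> cbox 0 1 \<and>
     (\<forall>N. \<exists>q\<ge>N. 1 \<le> q \<and> (\<exists>p :: int ^ 'n. \<forall>i. \<bar>y $ i - of_int (p $ i) / real q\<bar> < \<psi> (real q) / real q \<and>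
        gcd (p $ i) (int q) = 1))"
  (is "_ \<longleftrightarrow> _ \<and> (\<forall>N. \<exists>q\<ge>N. 1 \<le> q \<and> (\<exists>p. ?A q p))")
proof -
  let ?X = "{(q, p). 1 \<le> q \<and> ?A q p}"
  have fin: "finite {p. ?A q p}" if q: "1 \<le> q" for q
  proof -
    define b where "b = \<lceil>\<bar>\<psi> (real q)\<bar> + real q * Max (range (\<lambda>i. \<bar>y $ i\<bar>))\<rceil>"
    have "{p. ?A q p} \<subseteq> vec_lambda ` (UNIV \<rightarrow>\<^sub>E {-b..b})"
    proof
      fix p assume p: "p \<in> {p. ?A q p}"
      have "p $ i \<in> {-b..b}" for i
      proof -
        have "\<bar>y $ i - of_int (p $ i) / real q\<bar> < \<psi> (real q) / real q" using p by simp
        then have "real q * \<bar>y $ i - of_int (p $ i) / real q\<bar> < \<psi> (real q)" using q by (simp add: field_simps)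
        moreover have "real q * \<bar>y $ i - of_int (p $ i) / real q\<bar> = \<bar>real q * y $ i - of_int (p $ i)\<bar>"
        proof -
          have "real q * \<bar>y $ i - of_int (p $ i) / real q\<bar> = \<bar>real q * (y $ i - of_int (p $ i) / real q)\<bar>"
            by (simp add: abs_mult)
          also have "real q * (y $ i - of_int (p $ i) / real q) = real q * y $ i - of_int (p $ i)"
            using q by (simp add: field_simps)
          finally show ?thesis .
        qed
        moreover have "real q * \<bar>y $ i\<bar> \<le> real q * Max (range (\<lambda>i. \<bar>y $ i\<bar>))"
          by (intro mult_left_mono Max_ge) auto
        moreover have "\<bar>real q * y $ i\<bar> = real q * \<bar>y $ i\<bar>" by (simp add: abs_mult)
        moreover have "\<bar>of_int (p $ i)\<bar> \<le> \<bar>real q * y $ i - of_int (p $ i)\<bar> + \<bar>real q * y $ i\<bar>"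
          by linarith
        moreover have "\<psi> (real q) \<le> \<bar>\<psi> (real q)\<bar>" by simp
        ultimately have "\<bar>of_int (p $ i)\<bar> \<le> \<bar>\<psi> (real q)\<bar> + real q * Max (range (\<lambda>i. \<bar>y $ i\<bar>))"
          by linarith
        then have "\<bar>of_int (p $ i)\<bar> \<le> real_of_int b" unfolding b_def by linarith
        then show ?thesis by (simp add: abs_le_iff flip: of_int_abs)
      qed
      then show "p \<in> vec_lambda ` (UNIV \<rightarrow>\<^sub>E {-b..b})"
        by (intro image_eqI[of _ _ "vec_nth p"]) (auto simp: vec_nth_inverse)
    qed
    then show ?thesis by (rule finite_subset) (intro finite_imageI finite_PiE, auto)
  qed
  have "infinite ?X \<longleftrightarrow> (\<forall>N. \<exists>q\<ge>N. 1 \<le> q \<and> (\<exists>p. ?A q p))"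
  proof
    assume inf: "infinite ?X"
    show "\<forall>N. \<exists>q\<ge>N. 1 \<le> q \<and> (\<exists>p. ?A q p)"
    proof (rule ccontr)
      assume "\<not> ?thesis"
      then obtain N where N: "\<And>q p. N \<le> q \<Longrightarrow> 1 \<le> q \<Longrightarrow> \<not> ?A q p" by blast
      have "?X \<subseteq> (SIGMA q:{1..<N}. {p. ?A q p})"
      proof
        fix x assume "x \<in> ?X"
        then obtain q p where x: "x = (q, p)" "1 \<le> q" "?A q p" by blast
        then have "q < N" using N[of q p] by (meson not_less)
        with x show "x \<in> (SIGMA q:{1..<N}. {p. ?A q p})" by simp
      qed
      moreover have "finite (SIGMA q:{1..<N}. {p. ?A q p})" by (intro finite_SigmaI fin) auto
      ultimately show False using inf finite_subset by blast
    qed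
  next
    assume unb: "\<forall>N. \<exists>q\<ge>N. 1 \<le> q \<and> (\<exists>p. ?A q p)"
    show "infinite ?X"
    proof
      assume "finite ?X"
      then have "finite (fst ` ?X)" by simp
      then obtain N where N: "\<And>q. q \<in> fst ` ?X \<Longrightarrow> q \<le> N" by (meson finite_nat_set_iff_bounded_le)
      obtain q p where "Suc N \<le> q" "1 \<le> q" "?A q p" using unb by blast
      then show False using N[of q] by force
    qed
  qed
  then show ?thesis unfolding simul_approx_set_def by simp
qed

section \<open>Khintchine's theorem with decreasing radii\<close>

lemma null_sets_unit_cube_diff:
  fixes S :: "(real ^ 'n) set"
  assumes "emeasure lebesgue S = 1" "S \<subseteq> cbox 0 1"
  shows "cbox 0 1 - S \<in> null_sets lebesgue"
proof -
  have S: "S \<in> sets lebesgue" using assms(1) emeasure_notin_sets[of S lebesgue] by auto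
  have one: "(1 :: real ^ 'n) \<bullet> b = 1" if "b \<in> Basis" for b
    using that by (auto simp: Basis_vec_def inner_axis)
  have "emeasure lborel (cbox 0 1 :: (real ^ 'n) set) = 1"
    using emeasure_lborel_cbox[of 0 "1 :: real ^ 'n"] by (simp add: one)
  then have "emeasure lebesgue (cbox 0 1 :: (real ^ 'n) set) = 1" by simp
  then have "emeasure lebesgue (cbox 0 1 - S) = 0"
    using S assms by (subst emeasure_Diff) auto
  then show ?thesis using S by (auto simp: null_sets_def)
qed

text \<open>
  A measurable set \<open>U\<close> of measure at most a constant times \<open>\<delta> ^ CARD('n)\<close> that contains all points of the unit cube
  within \<open>\<delta> / q\<close> of a rational point with denominator \<open>q\<close>. As \<open>\<delta> \<le> 1\<close>, only numerators
  in \<open>{0..q}\<close> matter.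
\<close>

lemma rational_neighbourhoods_measure:
  assumes q: "0 < q" and \<delta>: "0 < \<delta>" "\<delta> \<le> 1"
  obtains U :: "(real ^ 'n) set" where "U \<in> sets lborel"
    "emeasure lborel U \<le> ennreal (unit_ball_vol (real CARD('n)) * (2 * real CARD('n) * \<delta>) ^ CARD('n))"
    "\<And>y p. y \<in> cbox 0 1 \<Longrightarrow> (\<And>i. \<bar>y $ i - of_int (p $ i) / real q\<bar> < \<delta> / real q) \<Longrightarrow> y \<in> U"
proof
  let ?k = "CARD('n)"
  let ?P = "vec_lambda ` (UNIV \<rightarrow>\<^sub>E {0..int q}) :: (int ^ 'n) set"
  define c :: "int ^ 'n \<Rightarrow> real ^ 'n" where "c p = (\<chi> i. of_int (p $ i) / real q)" for p
  let ?U = "\<Union>p\<in>?P. cball (c p) (real ?k * \<delta> / real q)"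
  let ?u = "unit_ball_vol (real ?k)"
  have fin: "finite ?P" by (intro finite_imageI finite_PiE) auto
  have u: "0 \<le> ?u" by simp
  show "?U \<in> sets lborel" using fin by (auto intro!: sets.finite_UN)
  have "card ?P \<le> card (UNIV \<rightarrow>\<^sub>E {0..int q} :: ('n \<Rightarrow> int) set)"
    by (intro card_image_le finite_PiE) auto
  also have "\<dots> = Suc q ^ ?k" by (simp add: card_PiE nat_add_distrib)
  also have "\<dots> \<le> (2 * q) ^ ?k" using q by (intro power_mono) auto
  finally have card: "real (card ?P) \<le> (2 * real q) ^ ?k"
    by (metis of_nat_le_iff of_nat_mult of_nat_numeral of_nat_power)
  have "emeasure lborel ?U \<le> (\<Sum>p\<in>?P. emeasure lborel (cball (c p) (real ?k * \<delta> / real q)))"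
    using fin by (intro emeasure_subadditive_finite) auto
  also have "\<dots> = (\<Sum>p\<in>?P. ennreal (?u * (real ?k * \<delta> / real q) ^ ?k))"
    using \<delta> by (simp add: emeasure_cball)
  also have "\<dots> = ennreal (real (card ?P) * (?u * (real ?k * \<delta> / real q) ^ ?k))"
    using \<delta> u by (simp add: ennreal_mult' ennreal_of_nat_eq_real_of_nat)
  also have "\<dots> \<le> ennreal ((2 * real q) ^ ?k * (?u * (real ?k * \<delta> / real q) ^ ?k))"
    using card \<delta> u by (intro ennreal_leI mult_right_mono) auto
  also have "(2 * real q) ^ ?k * (?u * (real ?k * \<delta> / real q) ^ ?k) = ?u * (2 * real ?k * \<delta>) ^ ?k"
  proof -
    have "(2 * real q) ^ ?k * (real ?k * \<delta> / real q) ^ ?k = (2 * real ?k * \<delta>) ^ ?k"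
      unfolding power_mult_distrib[symmetric] using q by (simp add: field_simps)
    then show ?thesis by (simp add: mult.left_commute)
  qed
  finally show "emeasure lborel ?U \<le> ennreal (?u * (2 * real ?k * \<delta>) ^ ?k)" .
  fix y :: "real ^ 'n" and p :: "int ^ 'n"
  assume y: "y \<in> cbox 0 1" and p: "\<And>i. \<bar>y $ i - of_int (p $ i) / real q\<bar> < \<delta> / real q"
  have "p $ i \<in> {0..int q}" for i
  proof -
    have yi: "0 \<le> y $ i" "y $ i \<le> 1" using y by (auto simp: mem_box_cart)
    have "\<bar>y $ i - of_int (p $ i) / real q\<bar> < 1 / real q"
      using p[of i] \<delta>(2) q by (smt (verit) divide_right_mono of_nat_0_less_iff)
    then have "of_int (p $ i) / real q < 1 + 1 / real q" "- 1 / real q < of_int (p $ i) / real q"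
      using yi by linarith+
    then have "real_of_int (p $ i) < real q + 1" "- 1 < real_of_int (p $ i)"
      using q by (auto simp: field_simps)
    then show ?thesis by auto
  qed
  then have "p \<in> ?P" by (intro image_eqI[of _ _ "vec_nth p"]) (auto simp: vec_nth_inverse)
  moreover have "dist (c p) y \<le> real ?k * \<delta> / real q"
  proof -
    have "dist (c p) y \<le> (\<Sum>i\<in>UNIV. \<bar>(c p - y) $ i\<bar>)" unfolding dist_norm by (rule norm_le_l1_cart)
    also have "\<dots> \<le> (\<Sum>i\<in>(UNIV :: 'n set). \<delta> / real q)"
      using p by (intro sum_mono) (auto simp: c_def abs_minus_commute less_imp_le)
    finally show ?thesis by simp
  qed
  ultimately show "y \<in> ?U" by auto
qed

text \<open>
  Khintchine's theorem for radii \<open>g q\<close> that decrease, without monotonicity of \<open>q * g q\<close>. It is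
  applied to the monotonic step function of \<open>monotone_step_function\<close>. By the Borel-Cantelli lemma
  almost every point has approximations from only finitely many blocks outside \<open>G\<close>, and on the blocks
  in \<open>G\<close> the step function is at most \<open>q * g q\<close>.
\<close>

lemma khintchine_decreasing_radius:
  fixes g :: "nat \<Rightarrow> real"
  assumes khintchine: "\<And>\<psi> :: real \<Rightarrow> real. pos_fun \<psi> \<Longrightarrow> monotonic_pos \<psi> \<Longrightarrow>
      (\<Sum>n. ennreal ((real (totient (Suc n)) * \<psi> (real (Suc n)) / real (Suc n)) ^ CARD('n))) = \<infinity> \<Longrightarrow>
      emeasure lebesgue (simul_approx_set \<psi> :: (real ^ 'n) set) = 1"
    and gpos: "\<And>n. 0 < n \<Longrightarrow> 0 < g n" and ganti: "\<And>m n. 0 < m \<Longrightarrow> m \<le> n \<Longrightarrow> g n \<le> g m"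
    and div: "\<not> summable (\<lambda>n. (real (totient (Suc n)) * g (Suc n)) ^ CARD('n))"
  shows "AE y in lborel. y \<in> cbox 0 1 \<longrightarrow> (\<forall>N. \<exists>q\<ge>N. 1 \<le> q \<and>
    (\<exists>p :: int ^ 'n. \<forall>i. \<bar>y $ i - of_int (p $ i) / real q\<bar> < g q \<and> gcd (p $ i) (int q) = 1))"
proof -
  define k where "k = CARD('n)"
  have k: "0 < k" by (simp add: k_def)
  obtain M :: "nat \<Rightarrow> real" and G where M: "\<And>j. 0 < M j" "\<And>j. M j \<le> 1" "\<And>i j. i \<le> j \<Longrightarrow> M j \<le> M i"
    "\<not> summable (\<lambda>j. 4 ^ j * M j)"
    "summable (\<lambda>j. if j \<in> G then 0 else 4 ^ j * M j)"
    "\<And>j n. j \<in> G \<Longrightarrow> 4 ^ j < n \<Longrightarrow> n \<le> 4 ^ Suc j \<Longrightarrow> M j \<le> (real n * g n) ^ k"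
    using monotone_step_function[OF gpos ganti k not_summable_condensation[OF gpos ganti div[folded k_def]]] by blast
  define \<theta> where "\<theta> j = root k (M j)" for j
  have \<theta>: "0 < \<theta> j" "\<theta> j ^ k = M j" "\<theta> j \<le> 1" for j
    using M(1)[of j] M(2)[of j] k by (auto simp: \<theta>_def real_root_pow_pos2)
  define \<psi> where "\<psi> x = \<theta> (level x)" for x
  have "emeasure lebesgue (simul_approx_set \<psi> :: (real ^ 'n) set) = 1"
  proof (rule khintchine)
    show "pos_fun \<psi>" using \<theta> by (simp add: pos_fun_def \<psi>_def)
    show "monotonic_pos \<psi>"
      unfolding monotonic_pos_def monotone_on_def \<psi>_def \<theta>_def
      using k M(3) level_mono by auto
    have "\<not> summable (\<lambda>n. (real (totient (Suc n)) / real (Suc n)) ^ k * M (level (real (Suc n))))"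
      using M(1,4) by (rule not_summable_level)
    also have "(\<lambda>n. (real (totient (Suc n)) / real (Suc n)) ^ k * M (level (real (Suc n))))
        = (\<lambda>n. (real (totient (Suc n)) * \<psi> (real (Suc n)) / real (Suc n)) ^ CARD('n))"
      by (simp add: \<theta>(2)[symmetric] \<psi>_def k_def power_mult_distrib power_divide)
    finally have diverges: "\<not> summable (\<lambda>n. (real (totient (Suc n)) * \<psi> (real (Suc n)) / real (Suc n)) ^ CARD('n))" .
    show "(\<Sum>n. ennreal ((real (totient (Suc n)) * \<psi> (real (Suc n)) / real (Suc n)) ^ CARD('n))) = \<infinity>"
    proof (rule ccontr)
      assume "\<not> ?thesis"
      then have "summable (\<lambda>n. (real (totient (Suc n)) * \<psi> (real (Suc n)) / real (Suc n)) ^ CARD('n))"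
        unfolding infinity_ennreal_def using \<theta>(1)
        by (intro summable_suminf_not_top zero_le_power divide_nonneg_nonneg mult_nonneg_nonneg)
          (simp_all add: \<psi>_def less_imp_le)
      with diverges show False ..
    qed
  qed
  then have "cbox 0 1 - simul_approx_set \<psi> \<in> null_sets (lebesgue :: (real ^ 'n) measure)"
    by (rule null_sets_unit_cube_diff) (auto simp: simul_approx_set_def)
  then have "AE y in lebesgue. y \<notin> cbox 0 1 - (simul_approx_set \<psi> :: (real ^ 'n) set)"
    by (rule AE_not_in)
  then have full: "AE y in lborel. y \<notin> cbox 0 1 - (simul_approx_set \<psi> :: (real ^ 'n) set)"
    by (simp only: AE_completion_iff)
  define u where "u = unit_ball_vol (real k) * (2 * real k) ^ k"
  have u: "0 \<le> u" by (simp add: u_def)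
  define R where "R j q V \<longleftrightarrow> V \<in> sets lborel \<and> emeasure lborel V \<le> ennreal (u * M j) \<and>
      (\<forall>y p. y \<in> cbox 0 1 \<longrightarrow> (\<forall>i. \<bar>y $ i - of_int (p $ i) / real q\<bar> < \<theta> j / real q) \<longrightarrow> y \<in> V)"
    for j q :: nat and V :: "(real ^ 'n) set"
  have ex: "\<exists>V. 0 < q \<longrightarrow> R j q V" for j q
  proof (cases "0 < q")
    case True
    obtain V :: "(real ^ 'n) set" where V: "V \<in> sets lborel"
      "emeasure lborel V \<le> ennreal (unit_ball_vol (real CARD('n)) * (2 * real CARD('n) * \<theta> j) ^ CARD('n))"
      "\<And>y p. y \<in> cbox 0 1 \<Longrightarrow> (\<And>i. \<bar>y $ i - of_int (p $ i) / real q\<bar> < \<theta> j / real q) \<Longrightarrow> y \<in> V"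
      using rational_neighbourhoods_measure[OF True \<theta>(1)[of j] \<theta>(3)[of j]] by blast
    have "unit_ball_vol (real CARD('n)) * (2 * real CARD('n) * \<theta> j) ^ CARD('n) = u * M j"
      unfolding u_def \<theta>(2)[of j, symmetric] k_def power_mult_distrib by (simp only: mult.assoc)
    then have "emeasure lborel V \<le> ennreal (u * M j)" using V(2) by simp
    moreover have "y \<in> V"
      if "y \<in> cbox 0 1" "\<forall>i. \<bar>y $ i - of_int (p $ i) / real q\<bar> < \<theta> j / real q" for y and p :: "int ^ 'n"
      by (rule V(3)[of y p]) (use that in auto)
    ultimately have "R j q V" using V(1) unfolding R_def by blast
    then show ?thesis by blast
  qed simp
  define U where "U j q = (SOME V. 0 < q \<longrightarrow> R j q V)" for j q
  have R: "R j q (U j q)" if "0 < q" for j q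
    using someI_ex[OF ex[of q j]] that by (simp add: U_def)
  have U: "U j q \<in> sets lborel" "emeasure lborel (U j q) \<le> ennreal (u * M j)"
      "y \<in> cbox 0 1 \<Longrightarrow> (\<And>i. \<bar>y $ i - of_int (p $ i) / real q\<bar> < \<theta> j / real q) \<Longrightarrow> y \<in> U j q"
    if "0 < q" for j q y and p :: "int ^ 'n"
    using R[OF that, of j] by (auto simp: R_def)
  define X where "X j = (if j \<in> G then {} else \<Union>q\<in>{4 ^ j<..4 ^ Suc j}. U j q)" for j
  have X_sets: "X j \<in> sets lborel" for j
    unfolding X_def using U(1) by (auto intro!: sets.finite_UN)
  define v where "v j = (if j \<in> G then 0 else 4 ^ j * M j)" for j
  have v: "0 \<le> v j" for j using M(1)[of j] by (simp add: v_def)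
  have X_le: "emeasure lborel (X j) \<le> ennreal (4 * u * v j)" for j
  proof (cases "j \<in> G")
    case False
    have "emeasure lborel (X j) \<le> (\<Sum>q\<in>{4 ^ j<..4 ^ Suc j}. emeasure lborel (U j q))"
      unfolding X_def using U(1) False by (auto intro!: emeasure_subadditive_finite)
    also have "\<dots> \<le> (\<Sum>q\<in>{4 ^ j<..(4::nat) ^ Suc j}. ennreal (u * M j))"
      by (intro sum_mono U(2)) auto
    also have "\<dots> = ennreal (real (card {4 ^ j<..(4::nat) ^ Suc j}) * (u * M j))"
      using u M(1)[of j] by (simp add: ennreal_mult' ennreal_of_nat_eq_real_of_nat)
    also have "\<dots> \<le> ennreal (4 * 4 ^ j * (u * M j))"
      using u M(1)[of j] by (intro ennreal_leI mult_right_mono) auto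
    finally show ?thesis using False by (simp add: v_def mult_ac)
  qed (simp add: X_def)
  have "AE y in lborel. eventually (\<lambda>j. y \<in> space lborel - X j) sequentially"
  proof (rule borel_cantelli_AE1[OF X_sets])
    show "emeasure lborel (X j) < \<infinity>" for j
      using X_le[of j] by (rule order.strict_trans1) simp
    show "summable (\<lambda>j. measure lborel (X j))"
    proof (rule summable_comparison_test')
      show "summable (\<lambda>j. 4 * u * v j)" using M(5) by (simp add: v_def[abs_def] summable_mult)
      show "norm (measure lborel (X j)) \<le> 4 * u * v j" for j
        using X_le[of j] u v[of j] by (simp add: measure_def enn2real_leI)
    qed
  qed
  with full show ?thesis
  proof eventually_elim
    case (elim y)
    show ?case
    proof (intro impI allI)
      fix N :: nat assume y: "y \<in> cbox 0 1"
      obtain J where J: "\<And>j. J \<le> j \<Longrightarrow> y \<notin> X j" using elim(2) by (auto simp: eventually_sequentially)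
      have "y \<in> simul_approx_set \<psi>" using elim(1) y by blast
      then obtain q p where q: "max N (4 ^ Suc J + 1) \<le> q" "1 \<le> q"
          and p: "\<And>i. \<bar>y $ i - of_int ((p :: int ^ 'n) $ i) / real q\<bar> < \<psi> (real q) / real q"
                 "\<And>i. gcd (p $ i) (int q) = 1"
        unfolding simul_approx_set_iff by blast
      define j where "j = level (real q)"
      have "real (4 ^ Suc J) < real q" using q(1) by (subst of_nat_less_iff) simp
      then have q4: "4 ^ Suc J < real q" by simp
      have "(1::real) \<le> 4 ^ Suc J" by (rule one_le_power) simp
      then have "1 < real q" using q4 by linarith
      then have "real (4 ^ j) < real q" "real q \<le> real (4 ^ Suc j)"
        using level_lower[of "real q"] level_upper[of "real q"] by (simp_all add: j_def)
      then have block: "4 ^ j < q" "q \<le> 4 ^ Suc j" unfolding of_nat_less_iff of_nat_le_iff by auto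
      have "(4::real) ^ Suc J < 4 ^ Suc j"
        using q4 level_upper[of "real q"] unfolding j_def by linarith
      then have "J \<le> j" by (simp add: power_strict_increasing_iff del: power_Suc)
      then have "y \<notin> X j" by (rule J)
      moreover have "y \<in> U j q" using p(1) q(2) y by (intro U(3)[of q y p]) (auto simp: \<psi>_def j_def)
      ultimately have "j \<in> G" using block by (auto simp: X_def split: if_splits)
      then have "\<theta> j ^ k \<le> (real q * g q) ^ k" using M(6) block \<theta>(2) by simp
      then have "\<theta> j \<le> real q * g q"
        using k gpos[of q] q(2) by (subst (asm) power_mono_iff) (auto simp: less_imp_le \<theta>(1))
      then have "\<psi> (real q) / real q \<le> g q" using q(2) by (simp add: \<psi>_def j_def field_simps)
      then show "\<exists>q\<ge>N. 1 \<le> q \<and> (\<exists>p :: int ^ 'n. \<forall>i. \<bar>y $ i - of_int (p $ i) / real q\<bar> < g q \<and> gcd (p $ i) (int q) = 1)"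
        using q p by (intro exI[of _ q] conjI exI[of _ p]) (auto intro: order_less_le_trans)
    qed
  qed
qed

section \<open>Jarnik's theorem\<close>

lemma not_summable_totient_ratio: "\<not> summable (\<lambda>n. (real (totient (Suc n)) / real (Suc n)) ^ k)"
proof -
  have "\<not> summable (\<lambda>j. (4::real) ^ j * 1)"
    by (simp add: summable_geometric_iff)
  from not_summable_level[OF _ this, of k] show ?thesis by simp
qed

lemma simul_approx_set_mono:
  assumes "\<And>q. 1 \<le> q \<Longrightarrow> \<psi> (real q) \<le> \<psi>' (real q)"
  shows "simul_approx_set \<psi> \<subseteq> simul_approx_set \<psi>'"
proof
  fix y :: "real ^ 'n" assume y: "y \<in> simul_approx_set \<psi>"
  show "y \<in> simul_approx_set \<psi>'"
    unfolding simul_approx_set_iff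
  proof (intro conjI allI)
    show "y \<in> cbox 0 1" using y by (simp add: simul_approx_set_iff)
    fix N
    obtain q p where q: "N \<le> q" "1 \<le> q"
      and p: "\<And>i. \<bar>y $ i - of_int ((p :: int ^ 'n) $ i) / real q\<bar> < \<psi> (real q) / real q"
        "\<And>i. gcd (p $ i) (int q) = 1"
      using y unfolding simul_approx_set_iff by blast
    have "\<psi> (real q) / real q \<le> \<psi>' (real q) / real q" using assms[OF q(2)] by (intro divide_right_mono) auto
    then show "\<exists>q\<ge>N. 1 \<le> q \<and> (\<exists>p :: int ^ 'n. \<forall>i. \<bar>y $ i - of_int (p $ i) / real q\<bar> < \<psi>' (real q) / real q \<and> gcd (p $ i) (int q) = 1)"
      using q p by (intro exI[of _ q] conjI exI[of _ p]) (auto intro: order_less_le_trans)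
  qed
qed

text \<open>
  The main case. With \<open>g q ^ k = f (\<psi> q / q)\<close>, Khintchine's theorem for the radii \<open>g q\<close> is the
  hypothesis on large balls of the mass transference principle.
\<close>

lemma hausdorff_measure_approx_infinite:
  fixes f \<psi> :: "real \<Rightarrow> real"
  assumes khintchine: "\<And>\<psi> :: real \<Rightarrow> real. pos_fun \<psi> \<Longrightarrow> monotonic_pos \<psi> \<Longrightarrow>
      (\<Sum>n. ennreal ((real (totient (Suc n)) * \<psi> (real (Suc n)) / real (Suc n)) ^ CARD('n))) = \<infinity> \<Longrightarrow>
      emeasure lebesgue (simul_approx_set \<psi> :: (real ^ 'n) set) = 1"
    and \<psi>: "pos_fun \<psi>" "antimono_on {0<..} \<psi>"
    and dim: "dimension_function f"
    and anti: "antimono_on {0<..} (\<lambda>s. f s / s ^ CARD('n))"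
    and unbounded: "\<And>M. \<exists>\<rho>>0. M < f \<rho> / \<rho> ^ CARD('n)"
    and div: "\<not> summable (\<lambda>n. f (\<psi> (real (Suc n)) / real (Suc n)) * real (totient (Suc n)) ^ CARD('n))"
  shows "hausdorff_measure f (simul_approx_set \<psi> :: (real ^ 'n) set) = \<infinity>"
proof -
  define k where "k = CARD('n)"
  have k: "0 < k" by (simp add: k_def)
  have dim_k: "DIM(real ^ 'n) = k" by (simp add: k_def)
  have fpos: "0 < f s" if "0 < s" for s
    using dim that by (auto simp: dimension_function_def pos_fun_def)
  have fmono: "f s \<le> f s'" if "0 < s" "s \<le> s'" for s s'
    using dim that unfolding dimension_function_def monotone_on_def by auto
  have \<psi>pos: "0 < \<psi> s" if "0 < s" for s using \<psi>(1) that by (simp add: pos_fun_def)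
  have \<psi>anti: "\<psi> s' \<le> \<psi> s" if "0 < s" "s \<le> s'" for s s'
    using \<psi>(2) that unfolding monotone_on_def by auto
  have fanti: "f s' / s' ^ k \<le> f s / s ^ k" if "0 < s" "s \<le> s'" for s s'
    using anti that unfolding monotone_on_def k_def by auto
  define g where "g n = root k (f (\<psi> (real n) / real n))" for n
  have ratio: "0 < \<psi> (real n) / real n" if "0 < n" for n using \<psi>pos[of "real n"] that by simp
  have g: "0 < g n" "g n ^ k = f (\<psi> (real n) / real n)" if "0 < n" for n
    using fpos[OF ratio[OF that]] k by (auto simp: g_def real_root_pow_pos2)
  have ganti: "g n \<le> g m" if mn: "0 < m" "m \<le> n" for m n
  proof -
    have "\<psi> (real n) / real n \<le> \<psi> (real m) / real m"
      using mn \<psi>pos[of "real n"] \<psi>anti[of "real m" "real n"] by (intro frac_le) auto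
    then show ?thesis using mn k ratio[of n] fmono unfolding g_def by simp
  qed
  have "\<not> summable (\<lambda>n. (real (totient (Suc n)) * g (Suc n)) ^ CARD('n))"
    using div g(2) by (simp add: power_mult_distrib k_def mult.commute)
  then have full: "AE y in lborel. y \<in> cbox 0 1 \<longrightarrow> (\<forall>N. \<exists>q\<ge>N. 1 \<le> q \<and>
    (\<exists>p :: int ^ 'n. \<forall>i. \<bar>y $ i - of_int (p $ i) / real q\<bar> < g q \<and> gcd (p $ i) (int q) = 1))"
    by (intro khintchine_decreasing_radius khintchine g(1) ganti)
  define I :: "(nat \<times> (int ^ 'n)) set" where "I = {(q, p). 1 \<le> q \<and> (\<forall>i. gcd (p $ i) (int q) = 1)}"
  define c :: "nat \<times> (int ^ 'n) \<Rightarrow> real ^ 'n" where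
    "c x = (\<chi> i. of_int (snd x $ i) / real (fst x))" for x
  \<comment> \<open>Half of \<open>\<psi> q / q\<close>, so that the closed Euclidean ball lies in the open cube that defines the approximation; the summand \<open>r x\<close> of \<open>R x\<close> ensures \<open>r x \<le> R x\<close>.\<close>
  define r :: "nat \<times> (int ^ 'n) \<Rightarrow> real" where "r x = \<psi> (real (fst x)) / (2 * real (fst x))" for x
  define R :: "nat \<times> (int ^ 'n) \<Rightarrow> real" where "R x = r x + real k * g (fst x)" for x
  define \<delta> where "\<delta> = f (\<psi> 1) / \<psi> 1 ^ k"
  have \<delta>: "0 < \<delta>" using fpos[of "\<psi> 1"] \<psi>pos[of 1] by (simp add: \<delta>_def)
  define K where "K = 2 ^ k * (1 / \<delta> + (2 * real k) ^ k)"
  have K: "0 < K" using \<delta> by (simp add: K_def add_pos_nonneg)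
  have r: "0 < r x" "r x \<le> \<psi> 1 / (2 * real (fst x))" if x: "x \<in> I" for x
  proof -
    have q: "1 \<le> fst x" using x by (auto simp: I_def)
    show "0 < r x" using q \<psi>pos[of "real (fst x)"] by (simp add: r_def)
    show "r x \<le> \<psi> 1 / (2 * real (fst x))"
      unfolding r_def using q by (intro divide_right_mono \<psi>anti) auto
  qed
  define E where "E = {x \<in> box 0 1. \<forall>N. \<exists>i\<in>I. N \<le> fst i \<and> x \<in> cball (c i) (r i)}"
  have "hausdorff_measure f E = \<infinity>"
    unfolding E_def
  proof (rule mass_transference[where R = R and K = K])
    show "antimono_on {0<..} (\<lambda>s. f s / s ^ DIM(real ^ 'n))" using anti by (simp add: dim_k k_def)
    show "\<exists>\<rho>>0. M < f \<rho> / \<rho> ^ DIM(real ^ 'n)" for M using unbounded by (simp add: dim_k k_def)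
    show "0 < r i \<and> r i \<le> R i \<and> R i ^ DIM(real ^ 'n) \<le> K * f (r i)" if i: "i \<in> I" for i
    proof (intro conjI)
      have q: "1 \<le> fst i" using i by (auto simp: I_def)
      show "0 < r i" by (rule r(1)[OF i])
      show "r i \<le> R i" using q g(1)[of "fst i"] by (simp add: R_def)
      have "r i \<le> \<psi> 1 / (2 * real (fst i))" by (rule r(2)[OF i])
      also have "\<dots> \<le> \<psi> 1" using q \<psi>pos[of 1] by (simp add: divide_le_eq)
      finally have "\<delta> \<le> f (r i) / r i ^ k" unfolding \<delta>_def using r(1)[OF i] by (intro fanti)
      then have small_power: "r i ^ k \<le> f (r i) / \<delta>" using r(1)[OF i] \<delta> by (simp add: field_simps)
      have "f (2 * r i) / (2 * r i) ^ k \<le> f (r i) / r i ^ k" using r(1)[OF i] by (intro fanti) auto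
      then have "f (2 * r i) \<le> 2 ^ k * f (r i)" using r(1)[OF i] by (simp add: field_simps)
      moreover have "g (fst i) ^ k = f (2 * r i)" using q g(2)[of "fst i"] by (simp add: r_def)
      ultimately have big_power: "(real k * g (fst i)) ^ k \<le> real k ^ k * (2 ^ k * f (r i))"
        by (simp add: power_mult_distrib mult_left_mono)
      have "R i ^ k \<le> (2 * max (r i) (real k * g (fst i))) ^ k"
        using r(1)[OF i] g(1)[of "fst i"] q by (intro power_mono) (auto simp: R_def)
      also have "\<dots> = 2 ^ k * max (r i) (real k * g (fst i)) ^ k" by (rule power_mult_distrib)
      also have "\<dots> \<le> 2 ^ k * (r i ^ k + (real k * g (fst i)) ^ k)"
        using r(1)[OF i] g(1)[of "fst i"] q by (intro mult_left_mono) (auto simp: max_def less_imp_le)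
      also have "\<dots> \<le> 2 ^ k * (f (r i) / \<delta> + real k ^ k * (2 ^ k * f (r i)))"
        by (intro mult_left_mono add_mono small_power big_power) simp
      also have "\<dots> = K * f (r i)" by (simp add: K_def algebra_simps power_mult_distrib)
      finally show "R i ^ DIM(real ^ 'n) \<le> K * f (r i)" by (simp only: dim_k)
    qed
    show "\<exists>N. \<forall>i\<in>I. N \<le> fst i \<longrightarrow> R i < \<rho>" if \<rho>: "0 < \<rho>" for \<rho>
    proof -
      define \<epsilon> where "\<epsilon> = \<rho> / (2 * real k)"
      have \<epsilon>: "0 < \<epsilon>" using \<rho> k by (simp add: \<epsilon>_def)
      have "eventually (\<lambda>y. f y < \<epsilon> ^ k) (at_right 0)"
        using dim \<epsilon> by (auto simp: dimension_function_def intro: order_tendstoD)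
      then obtain d where d: "0 < d" "\<And>y. 0 < y \<Longrightarrow> y < d \<Longrightarrow> f y < \<epsilon> ^ k"
        by (auto simp: eventually_at_right_field)
      define d' where "d' = min d \<rho>"
      have d': "0 < d'" using d(1) \<rho> by (simp add: d'_def)
      obtain N :: nat where N: "\<psi> 1 / d' < real N" using reals_Archimedean2 by blast
      show ?thesis
      proof (intro exI ballI impI)
        fix i assume i: "i \<in> I" "N \<le> fst i"
        have q: "1 \<le> fst i" using i by (auto simp: I_def)
        have "\<psi> 1 / d' < real (fst i)" using N i(2) by linarith
        then have less: "\<psi> 1 / real (fst i) < d'" using d' q by (simp add: field_simps)
        have "2 * r i \<le> \<psi> 1 / real (fst i)" using r(2)[OF i(1)] by simp
        with less have r2: "2 * r i < d" "2 * r i < \<rho>" by (auto simp: d'_def)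
        have "g (fst i) ^ k = f (2 * r i)" using q g(2)[of "fst i"] by (simp add: r_def)
        also have "\<dots> < \<epsilon> ^ k" using r2 r(1)[OF i(1)] by (intro d(2)) auto
        finally have "g (fst i) < \<epsilon>" using \<epsilon> by (metis less_imp_le power_less_imp_less_base)
        then have "real k * g (fst i) < \<rho> / 2" using k by (simp add: \<epsilon>_def field_simps)
        then show "R i < \<rho>" using r2 by (simp add: R_def)
      qed
    qed
    have "(\<chi> i. 1 / 2) \<in> (box 0 1 :: (real ^ 'n) set)" by (simp add: mem_box_cart)
    then show "box 0 1 \<noteq> ({} :: (real ^ 'n) set)" by blast
    show "AE x in lborel. x \<in> box 0 1 \<longrightarrow> (\<exists>i\<in>I. N \<le> fst i \<and> x \<in> cball (c i) (R i))" for N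
      using full
    proof eventually_elim
      case (elim x)
      show ?case
      proof
        assume "x \<in> box 0 1"
        then have "x \<in> cbox 0 1" using box_subset_cbox by blast
        with elim obtain q p where q: "N \<le> q" "1 \<le> q"
          and p: "\<And>i. \<bar>x $ i - of_int ((p :: int ^ 'n) $ i) / real q\<bar> < g q" "\<And>i. gcd (p $ i) (int q) = 1"
          by blast
        have "dist (c (q, p)) x \<le> (\<Sum>i\<in>UNIV. \<bar>(c (q, p) - x) $ i\<bar>)"
          unfolding dist_norm by (rule norm_le_l1_cart)
        also have "\<dots> \<le> (\<Sum>i\<in>(UNIV :: 'n set). g q)"
          using p(1) by (intro sum_mono) (auto simp: c_def abs_minus_commute less_imp_le)
        also have "\<dots> = real k * g q" by (simp add: k_def)
        finally have "x \<in> cball (c (q, p)) (R (q, p))"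
          using r(1)[of "(q, p)"] q p(2) by (auto simp: R_def I_def)
        then show "\<exists>i\<in>I. N \<le> fst i \<and> x \<in> cball (c i) (R i)"
          using q p(2) by (intro bexI[of _ "(q, p)"]) (auto simp: I_def)
      qed
    qed
  qed (use dim K open_box in auto)
  moreover have "E \<subseteq> simul_approx_set \<psi>"
  proof
    fix x assume x: "x \<in> E"
    show "x \<in> simul_approx_set \<psi>"
      unfolding simul_approx_set_iff
    proof (intro conjI allI)
      show "x \<in> cbox 0 1" using x box_subset_cbox by (auto simp: E_def)
      fix N
      obtain q p where qp: "(q, p) \<in> I" "N \<le> q" "dist (c (q, p)) x \<le> r (q, p)"
        using x by (force simp: E_def)
      have q: "1 \<le> q" "\<And>i. gcd (p $ i) (int q) = 1" using qp(1) by (auto simp: I_def)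
      have "\<bar>x $ i - of_int (p $ i) / real q\<bar> < \<psi> (real q) / real q" for i
      proof -
        have "\<bar>x $ i - of_int (p $ i) / real q\<bar> = \<bar>(x - c (q, p)) $ i\<bar>" by (simp add: c_def)
        also have "\<dots> \<le> norm (x - c (q, p))" by (rule component_le_norm_cart)
        also have "\<dots> \<le> r (q, p)" using qp(3) by (simp add: dist_norm norm_minus_commute)
        also have "\<dots> < \<psi> (real q) / real q"
          using q(1) \<psi>pos[of "real q"] by (simp add: r_def divide_strict_left_mono)
        finally show ?thesis .
      qed
      then show "\<exists>q\<ge>N. 1 \<le> q \<and> (\<exists>p :: int ^ 'n. \<forall>i. \<bar>x $ i - of_int (p $ i) / real q\<bar> < \<psi> (real q) / real q \<and> gcd (p $ i) (int q) = 1)"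
        using qp(2) q by blast
    qed
  qed
  ultimately show ?thesis
    using hausdorff_measure_mono[of E "simul_approx_set \<psi>" f] by (simp add: top_unique)
qed

lemma simul_approx_set_full:
  fixes \<psi> :: "real \<Rightarrow> real"
  assumes khintchine: "\<And>\<psi> :: real \<Rightarrow> real. pos_fun \<psi> \<Longrightarrow> monotonic_pos \<psi> \<Longrightarrow>
      (\<Sum>n. ennreal ((real (totient (Suc n)) * \<psi> (real (Suc n)) / real (Suc n)) ^ CARD('n))) = \<infinity> \<Longrightarrow>
      emeasure lebesgue (simul_approx_set \<psi> :: (real ^ 'n) set) = 1"
    and \<psi>: "pos_fun \<psi>" "monotonic_pos \<psi>"
    and div: "\<not> summable (\<lambda>n. (real (totient (Suc n)) * \<psi> (real (Suc n)) / real (Suc n)) ^ CARD('n))"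
  shows "cbox 0 1 - simul_approx_set \<psi> \<in> null_sets (lebesgue :: (real ^ 'n) measure)"
proof (rule null_sets_unit_cube_diff[OF khintchine[OF \<psi>]])
  have nonneg: "0 \<le> (real (totient (Suc n)) * \<psi> (real (Suc n)) / real (Suc n)) ^ CARD('n)" for n
    using \<psi>(1) by (intro zero_le_power divide_nonneg_nonneg mult_nonneg_nonneg) (auto simp: pos_fun_def less_imp_le)
  show "(\<Sum>n. ennreal ((real (totient (Suc n)) * \<psi> (real (Suc n)) / real (Suc n)) ^ CARD('n))) = \<infinity>"
  proof (rule ccontr)
    assume "\<not> ?thesis"
    then have "summable (\<lambda>n. (real (totient (Suc n)) * \<psi> (real (Suc n)) / real (Suc n)) ^ CARD('n))"
      unfolding infinity_ennreal_def by (intro summable_suminf_not_top nonneg)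
    with div show False ..
  qed
qed (auto simp: simul_approx_set_def)

theorem corollary2:
  assumes khintchine: "\<And>\<psi> :: real \<Rightarrow> real. pos_fun \<psi> \<Longrightarrow> monotonic_pos \<psi> \<Longrightarrow>
      (\<Sum>n. ennreal ((real (totient (Suc n)) * \<psi> (real (Suc n)) / real (Suc n)) ^ CARD('n))) = \<infinity> \<Longrightarrow>
      emeasure lebesgue (simul_approx_set \<psi> :: (real ^ 'n) set) = 1"
  shows "\<forall>\<psi> f :: real \<Rightarrow> real. pos_fun \<psi> \<longrightarrow> monotonic_pos \<psi> \<longrightarrow>
      dimension_function f \<longrightarrow> monotonic_pos (\<lambda>r. f r / r ^ CARD('n)) \<longrightarrow>
      (\<Sum>n. ennreal (f (\<psi> (real (Suc n)) / real (Suc n)) * real (totient (Suc n)) ^ CARD('n))) = \<infinity> \<longrightarrow>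
      hausdorff_measure f (simul_approx_set \<psi> :: (real ^ 'n) set) = hausdorff_measure f (cbox 0 1 :: (real ^ 'n) set)"
proof (intro allI impI)
  fix \<psi> f :: "real \<Rightarrow> real"
  assume \<psi>: "pos_fun \<psi>" "monotonic_pos \<psi>" and dim: "dimension_function f"
    and mon: "monotonic_pos (\<lambda>r. f r / r ^ CARD('n))"
    and div: "(\<Sum>n. ennreal (f (\<psi> (real (Suc n)) / real (Suc n)) * real (totient (Suc n)) ^ CARD('n))) = \<infinity>"
  define k where "k = CARD('n)"
  let ?Q = "cbox 0 1 :: (real ^ 'n) set"
  let ?S = "\<lambda>\<psi>. simul_approx_set \<psi> :: (real ^ 'n) set"
  have fpos: "0 < f s" if "0 < s" for s
    using dim that by (auto simp: dimension_function_def pos_fun_def)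
  have \<psi>pos: "0 < \<psi> s" if "0 < s" for s using \<psi>(1) that by (simp add: pos_fun_def)
  have div: "\<not> summable (\<lambda>n. f (\<psi> (real (Suc n)) / real (Suc n)) * real (totient (Suc n)) ^ CARD('n))"
  proof
    assume "summable (\<lambda>n. f (\<psi> (real (Suc n)) / real (Suc n)) * real (totient (Suc n)) ^ CARD('n))"
    then have "(\<Sum>n. ennreal (f (\<psi> (real (Suc n)) / real (Suc n)) * real (totient (Suc n)) ^ CARD('n))) \<noteq> top"
      using fpos \<psi>pos by (intro ennreal_suminf_neq_top) (auto simp: less_imp_le)
    with div show False by simp
  qed
  have cube: "?S \<psi> \<subseteq> cbox 0 1" by (auto simp: simul_approx_set_def)
  \<comment> \<open>A nondecreasing \<open>\<psi>\<close> is compared with the constant function \<open>\<psi> 1\<close>.\<close>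
  define c where "c = \<psi> 1"
  have c: "0 < c" using \<psi>pos by (simp add: c_def)
  have const: "pos_fun (\<lambda>_. c)" "monotonic_pos (\<lambda>_. c)" "antimono_on {0<..} (\<lambda>_::real. c)"
    using c by (auto simp: pos_fun_def monotonic_pos_def monotone_on_def)
  have const_div: "\<not> summable (\<lambda>n. (real (totient (Suc n)) * c / real (Suc n)) ^ k)"
  proof -
    have "(\<lambda>n. (real (totient (Suc n)) * c / real (Suc n)) ^ k)
        = (\<lambda>n. c ^ k * (real (totient (Suc n)) / real (Suc n)) ^ k)"
      by (simp add: power_mult_distrib[symmetric] mult.commute)
    then show ?thesis using c not_summable_totient_ratio[of k] by (simp add: summable_cmult_iff)
  qed
  have const_sub: "?S (\<lambda>_. c) \<subseteq> ?S \<psi>" if "mono_on {0<..} \<psi>"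
    using that unfolding c_def by (intro simul_approx_set_mono) (auto simp: monotone_on_def)
  \<comment> \<open>In the first case the \<open>f\<close>-measure vanishes on Lebesgue null sets; in the second one \<open>f r / r ^ k\<close> is nonincreasing and unbounded near \<open>0\<close>, and both measures are infinite.\<close>
  show "hausdorff_measure f (?S \<psi>) = hausdorff_measure f ?Q"
  proof (cases "\<exists>B. \<forall>s. 0 < s \<and> s \<le> 1 \<longrightarrow> f s \<le> B * s ^ k")
    case True
    then obtain B where B: "\<And>s. 0 < s \<Longrightarrow> s \<le> 1 \<Longrightarrow> f s \<le> B * s ^ k" by blast
    have "cbox 0 1 - ?S \<psi> \<in> null_sets lebesgue"
    proof (cases "mono_on {0<..} \<psi>")
      case True
      have "cbox 0 1 - ?S (\<lambda>_. c) \<in> null_sets lebesgue"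
        using khintchine const(1,2) const_div unfolding k_def by (rule simul_approx_set_full)
      moreover have "cbox 0 1 - ?S \<psi> \<subseteq> cbox 0 1 - ?S (\<lambda>_. c)" using const_sub[OF True] by blast
      ultimately show ?thesis by (rule null_sets_completion_subset[rotated])
    next
      case False
      then have anti: "antimono_on {0<..} \<psi>" using \<psi>(2) by (simp add: monotonic_pos_def)
      obtain N :: nat where N: "c < real N" using reals_Archimedean2 by blast
      show ?thesis
      proof (rule simul_approx_set_full[OF khintchine \<psi>])
        show "\<not> summable (\<lambda>n. (real (totient (Suc n)) * \<psi> (real (Suc n)) / real (Suc n)) ^ CARD('n))"
        proof
          assume "summable (\<lambda>n. (real (totient (Suc n)) * \<psi> (real (Suc n)) / real (Suc n)) ^ CARD('n))"
          then have "summable (\<lambda>n. B * (real (totient (Suc n)) * \<psi> (real (Suc n)) / real (Suc n)) ^ CARD('n))"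
            by (rule summable_mult)
          then have "summable (\<lambda>n. f (\<psi> (real (Suc n)) / real (Suc n)) * real (totient (Suc n)) ^ CARD('n))"
          proof (rule summable_comparison_test'[where N = N])
            fix n assume n: "N \<le> n"
            let ?s = "\<psi> (real (Suc n)) / real (Suc n)"
            have s: "0 < ?s" using \<psi>pos by simp
            have "\<psi> (real (Suc n)) \<le> c" unfolding c_def using anti by (auto simp: monotone_on_def)
            then have "?s \<le> 1" using N n by simp
            then have "f ?s \<le> B * ?s ^ k" using s by (intro B)
            then have "f ?s * real (totient (Suc n)) ^ k \<le> B * ?s ^ k * real (totient (Suc n)) ^ k"
              by (intro mult_right_mono) auto
            then show "norm (f ?s * real (totient (Suc n)) ^ CARD('n))
                \<le> B * (real (totient (Suc n)) * \<psi> (real (Suc n)) / real (Suc n)) ^ CARD('n)"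
              using fpos[OF s] by (simp add: k_def power_mult_distrib power_divide mult_ac)
          qed
          with div show False ..
        qed
      qed
    qed
    then have "hausdorff_measure f ?Q \<le> hausdorff_measure f (?S \<psi>)"
      using B by (intro hausdorff_measure_diff_null) (auto simp: k_def)
    then show ?thesis using hausdorff_measure_mono[OF cube, of f] by (rule antisym[rotated])
  next
    case False
    have unbounded: "\<exists>\<rho>>0. M < f \<rho> / \<rho> ^ k" for M
    proof -
      obtain s where "0 < s" "\<not> f s \<le> M * s ^ k" using False by blast
      then show ?thesis by (intro exI[of _ s]) (simp add: field_simps)
    qed
    have anti: "antimono_on {0<..} (\<lambda>r. f r / r ^ k)"
    proof (rule ccontr)
      assume "\<not> ?thesis"
      then have mono: "mono_on {0<..} (\<lambda>r. f r / r ^ k)" using mon by (auto simp: monotonic_pos_def k_def)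
      have "f s / s ^ k \<le> f 1 / 1 ^ k" if "0 < s" "s \<le> 1" for s
        using monotone_onD[OF mono, of s 1] that by simp
      then have "f s \<le> f 1 * s ^ k" if "0 < s" "s \<le> 1" for s
        using that by (simp add: field_simps)
      with False show False by blast
    qed
    have "hausdorff_measure f (?S \<psi>) = \<infinity>"
    proof (cases "mono_on {0<..} \<psi>")
      case True
      have "hausdorff_measure f (?S (\<lambda>_. c)) = \<infinity>"
      proof (rule hausdorff_measure_approx_infinite[OF khintchine const(1,3) dim])
        show "antimono_on {0<..} (\<lambda>s. f s / s ^ CARD('n))" using anti by (simp add: k_def)
        show "\<exists>\<rho>>0. M < f \<rho> / \<rho> ^ CARD('n)" for M using unbounded by (simp add: k_def)
        show "\<not> summable (\<lambda>n. f (c / real (Suc n)) * real (totient (Suc n)) ^ CARD('n))"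
        proof
          assume "summable (\<lambda>n. f (c / real (Suc n)) * real (totient (Suc n)) ^ CARD('n))"
          then have "summable (\<lambda>n. c ^ k / f c * (f (c / real (Suc n)) * real (totient (Suc n)) ^ k))"
            unfolding k_def by (rule summable_mult)
          then have "summable (\<lambda>n. (real (totient (Suc n)) * c / real (Suc n)) ^ k)"
          proof (rule summable_comparison_test')
            fix n
            let ?s = "c / real (Suc n)"
            have s: "0 < ?s" "?s \<le> c" using c by (auto simp: divide_le_eq)
            have "f c / c ^ k \<le> f ?s / ?s ^ k"
              using anti s c unfolding monotone_on_def by (metis greaterThan_iff)
            then have "?s ^ k \<le> c ^ k / f c * f ?s"
              using s c fpos[OF c] by (simp add: pos_le_divide_eq pos_divide_le_eq mult.commute del: of_nat_Suc)
            then have "?s ^ k * real (totient (Suc n)) ^ k \<le> c ^ k / f c * f ?s * real (totient (Suc n)) ^ k"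
              by (intro mult_right_mono) auto
            then show "norm ((real (totient (Suc n)) * c / real (Suc n)) ^ k)
                \<le> c ^ k / f c * (f ?s * real (totient (Suc n)) ^ k)"
              using c by (simp add: power_mult_distrib power_divide mult_ac)
          qed
          with const_div show False ..
        qed
      qed
      then show ?thesis using hausdorff_measure_mono[OF const_sub[OF True], of f] by (simp add: top_unique)
    next
      case False
      then have "antimono_on {0<..} \<psi>" using \<psi>(2) by (simp add: monotonic_pos_def)
      then show ?thesis
        using hausdorff_measure_approx_infinite[OF khintchine \<psi>(1) _ dim] anti unbounded div
        unfolding k_def by blast
    qed
    then show ?thesis using hausdorff_measure_mono[OF cube, of f] by (simp add: top_unique)
  qed
qed

end
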